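(* For each of the following properties $P$, the set $\mathcal{G}_P$ of enumerated groups with property $P$ is a closed subspace of $\mathcal{G}$, and hence inherits a Polish topology: left orderability; biorderability; local indicability; the unique product property; soficity; torsion-freeness.
   Context: An enumerated group is a group whose underlying set is $\mathbf{N}=\{1,2,3,\ldots\}$. The set $\mathcal{G}$ of enumerated groups is identified, via (multiplication, inversion, identity), with a subset of $\mathbf{N}^{\mathbf{N}\times\mathbf{N}}\times\mathbf{N}^{\mathbf{N}}\times\mathbf{N}$ (product topology, $\mathbf{N}$ discrete) and given the subspace topology; it is a Polish space. A group is left orderable (resp. biorderable) if it admits a total order invariant under left (resp. left and right) translation; locally indicable if every nontrivial finitely generated subgroup has an infinite cyclic quotient. A group $G$ has the unique product property if for all nonempty finite $X,Y\subset G$ there is $g\in G$ such that $g=xy$ for some $x\in X$, $y\in Y$, but $g\neq x'y'$ for all $x'\in X\setminus\{x\}$, $y'\in Y\setminus\{y\}$. Soficity: let $G$ be a finitely generated group with finite symmetric generating set $S$. A finite directed graph $\Gamma$ with edges labeled by elements of $S$ is an $n$-approximation of the Cayley graph $Cay(G,S)$ if there is $W\subseteq V(\Gamma)$ with $|W|>(1-\frac1n)|V(\Gamma)|$ such that for every $p\in W$ the $n$-neighborhood of $p$ is rooted isomorphic, as an edge-labeled graph, to the $n$-neighborhood of a vertex of $Cay(G,S)$. A finitely generated group $G$ is sofic if for some (equivalently, any) such $S$ and every $n>1$ there is a finite graph that is an $n$-approximation of $Cay(G,S)$. An arbitrary group is sofic if all its finitely generated subgroups are. *)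

theory Defs
  imports "HOL-Analysis.Analysis" "HOL-Algebra.Elementary_Groups"
begin

section \<open>The space of enumerated groups\<close>

abbreviation Pos :: "nat set" where
  "Pos \<equiv> {1..}"

type_synonym group_code = "(nat \<times> nat \<Rightarrow> nat) \<times> (nat \<Rightarrow> nat) \<times> nat"

text \<open>The points of a product topology are the extensional functions on its index set, so
  distinct elements of the ambient space below really are distinct functions on \<^term>\<open>Pos\<close>.\<close>

definition code_topology :: "group_code topology" where
  "code_topology =
     prod_topology (product_topology (\<lambda>_. discrete_topology Pos) (Pos \<times> Pos))
       (prod_topology (product_topology (\<lambda>_. discrete_topology Pos) Pos)
         (discrete_topology Pos))"

definition coded_monoid :: "group_code \<Rightarrow> nat monoid" where
  "coded_monoid = (\<lambda>(m, i, e). \<lparr>carrier = Pos, monoid.mult = (\<lambda>x y. m (x, y)), one = e\<rparr>)"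

definition enumerated_groups :: "group_code set" where
  "enumerated_groups =
     {(m, i, e) \<in> topspace code_topology.
        group (coded_monoid (m, i, e)) \<and> (\<forall>x\<in>Pos. i x = inv\<^bsub>coded_monoid (m, i, e)\<^esub> x)}"

definition enumerated_group_space :: "group_code topology" where
  "enumerated_group_space = subtopology code_topology enumerated_groups"

definition polish_topology :: "'a topology \<Rightarrow> bool" where
  "polish_topology X \<longleftrightarrow> completely_metrizable_space X \<and> separable_space X"


section \<open>Properties of groups\<close>

definition left_invariant :: "('a, 'b) monoid_scheme \<Rightarrow> 'a rel \<Rightarrow> bool" where
  "left_invariant G r \<longleftrightarrow> (\<forall>g\<in>carrier G. \<forall>(x, y)\<in>r. (g \<otimes>\<^bsub>G\<^esub> x, g \<otimes>\<^bsub>G\<^esub> y) \<in> r)"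

definition right_invariant :: "('a, 'b) monoid_scheme \<Rightarrow> 'a rel \<Rightarrow> bool" where
  "right_invariant G r \<longleftrightarrow> (\<forall>g\<in>carrier G. \<forall>(x, y)\<in>r. (x \<otimes>\<^bsub>G\<^esub> g, y \<otimes>\<^bsub>G\<^esub> g) \<in> r)"

definition left_orderable :: "('a, 'b) monoid_scheme \<Rightarrow> bool" where
  "left_orderable G \<longleftrightarrow> (\<exists>r. linear_order_on (carrier G) r \<and> left_invariant G r)"

definition biorderable :: "('a, 'b) monoid_scheme \<Rightarrow> bool" where
  "biorderable G \<longleftrightarrow>
     (\<exists>r. linear_order_on (carrier G) r \<and> left_invariant G r \<and> right_invariant G r)"

definition finitely_generated :: "('a, 'b) monoid_scheme \<Rightarrow> bool" where
  "finitely_generated G \<longleftrightarrow> (\<exists>S. finite S \<and> S \<subseteq> carrier G \<and> generate G S = carrier G)"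

definition has_infinite_cyclic_quotient :: "('a, 'b) monoid_scheme \<Rightarrow> bool" where
  "has_infinite_cyclic_quotient G \<longleftrightarrow> (\<exists>N. N \<lhd> G \<and> G Mod N \<cong> integer_group)"

definition locally_indicable :: "('a, 'b) monoid_scheme \<Rightarrow> bool" where
  "locally_indicable G \<longleftrightarrow>
     (\<forall>H. subgroup H G \<and> H \<noteq> {\<one>\<^bsub>G\<^esub>} \<and> finitely_generated (G\<lparr>carrier := H\<rparr>) \<longrightarrow>
        has_infinite_cyclic_quotient (G\<lparr>carrier := H\<rparr>))"

definition unique_product_property :: "('a, 'b) monoid_scheme \<Rightarrow> bool" where
  "unique_product_property G \<longleftrightarrow>
     (\<forall>X Y. finite X \<and> X \<noteq> {} \<and> X \<subseteq> carrier G \<and> finite Y \<and> Y \<noteq> {} \<and> Y \<subseteq> carrier G \<longrightarrow>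
        (\<exists>g\<in>carrier G. \<exists>x\<in>X. \<exists>y\<in>Y. g = x \<otimes>\<^bsub>G\<^esub> y \<and>
           (\<forall>x'\<in>X - {x}. \<forall>y'\<in>Y - {y}. g \<noteq> x' \<otimes>\<^bsub>G\<^esub> y')))"

definition torsion_free :: "('a, 'b) monoid_scheme \<Rightarrow> bool" where
  "torsion_free G \<longleftrightarrow>
     (\<forall>x\<in>carrier G. \<forall>n::nat. n > 0 \<and> x [^]\<^bsub>G\<^esub> n = \<one>\<^bsub>G\<^esub> \<longrightarrow> x = \<one>\<^bsub>G\<^esub>)"


section \<open>Soficity\<close>

text \<open>An edge \<open>(u, s, v)\<close> runs from \<open>u\<close> to \<open>v\<close> and carries the label \<open>s\<close>.\<close>

record ('v, 'l) labeled_digraph =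
  vertices :: "'v set"
  edges :: "('v \<times> 'l \<times> 'v) set"

definition finite_labeled_digraph :: "'l set \<Rightarrow> ('v, 'l) labeled_digraph \<Rightarrow> bool" where
  "finite_labeled_digraph S \<Gamma> \<longleftrightarrow>
     finite (vertices \<Gamma>) \<and> edges \<Gamma> \<subseteq> vertices \<Gamma> \<times> S \<times> vertices \<Gamma>"

definition adjacency :: "('v, 'l) labeled_digraph \<Rightarrow> 'v rel" where
  "adjacency \<Gamma> = {(u, v). \<exists>s. (u, s, v) \<in> edges \<Gamma> \<or> (v, s, u) \<in> edges \<Gamma>}"

text \<open>Vertices at distance at most \<open>n\<close> from \<open>p\<close> in the underlying undirected graph, together
  with all edges between them.\<close>

definition graph_ball :: "('v, 'l) labeled_digraph \<Rightarrow> nat \<Rightarrow> 'v \<Rightarrow> 'v set" where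
  "graph_ball \<Gamma> n p = {q \<in> vertices \<Gamma>. \<exists>k\<le>n. (p, q) \<in> adjacency \<Gamma> ^^ k}"

definition neighborhood :: "('v, 'l) labeled_digraph \<Rightarrow> nat \<Rightarrow> 'v \<Rightarrow> ('v, 'l) labeled_digraph"
  where
  "neighborhood \<Gamma> n p =
     \<lparr>vertices = graph_ball \<Gamma> n p,
      edges = {(u, s, v) \<in> edges \<Gamma>. u \<in> graph_ball \<Gamma> n p \<and> v \<in> graph_ball \<Gamma> n p}\<rparr>"

definition rooted_isomorphic ::
  "('v, 'l) labeled_digraph \<Rightarrow> 'v \<Rightarrow> ('w, 'l) labeled_digraph \<Rightarrow> 'w \<Rightarrow> bool" where
  "rooted_isomorphic \<Gamma> p \<Delta> q \<longleftrightarrow>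
     (\<exists>f. bij_betw f (vertices \<Gamma>) (vertices \<Delta>) \<and> f p = q \<and>
        (\<forall>u\<in>vertices \<Gamma>. \<forall>v\<in>vertices \<Gamma>. \<forall>s.
           (u, s, v) \<in> edges \<Gamma> \<longleftrightarrow> (f u, s, f v) \<in> edges \<Delta>))"

definition cayley_graph :: "('a, 'b) monoid_scheme \<Rightarrow> 'a set \<Rightarrow> ('a, 'a) labeled_digraph" where
  "cayley_graph G S =
     \<lparr>vertices = carrier G,
      edges = {(g, s, h). g \<in> carrier G \<and> s \<in> S \<and> h = g \<otimes>\<^bsub>G\<^esub> s}\<rparr>"

definition cayley_approximation ::
  "('a, 'b) monoid_scheme \<Rightarrow> 'a set \<Rightarrow> nat \<Rightarrow> ('v, 'a) labeled_digraph \<Rightarrow> bool" where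
  "cayley_approximation G S n \<Gamma> \<longleftrightarrow>
     finite_labeled_digraph S \<Gamma> \<and>
     (\<exists>W \<subseteq> vertices \<Gamma>.
        real (card W) > (1 - 1 / real n) * real (card (vertices \<Gamma>)) \<and>
        (\<forall>p\<in>W. \<exists>g\<in>carrier G.
           rooted_isomorphic (neighborhood \<Gamma> n p) p (neighborhood (cayley_graph G S) n g) g))"

definition symmetric_generating_set :: "('a, 'b) monoid_scheme \<Rightarrow> 'a set \<Rightarrow> bool" where
  "symmetric_generating_set G S \<longleftrightarrow>
     S \<subseteq> carrier G \<and> (\<forall>s\<in>S. inv\<^bsub>G\<^esub> s \<in> S) \<and> generate G S = carrier G"

text \<open>Every finite graph has an isomorphic copy with vertices in \<^typ>\<open>nat\<close>, so fixing the vertex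
  type of the approximating graphs loses nothing.\<close>

definition fg_sofic :: "('a, 'b) monoid_scheme \<Rightarrow> bool" where
  "fg_sofic G \<longleftrightarrow>
     (\<exists>S. finite S \<and> symmetric_generating_set G S \<and>
        (\<forall>n>1. \<exists>\<Gamma> :: (nat, 'a) labeled_digraph. cayley_approximation G S n \<Gamma>))"

definition sofic :: "('a, 'b) monoid_scheme \<Rightarrow> bool" where
  "sofic G \<longleftrightarrow>
     (\<forall>H. subgroup H G \<and> finitely_generated (G\<lparr>carrier := H\<rparr>) \<longrightarrow>
        fg_sofic (G\<lparr>carrier := H\<rparr>))"

end

theory Submission
  imports Defs
begin

text \<open>
  Near a given enumerated group, the identity, inverses and the value of any fixed word are
  constant. A condition on finitely many such values therefore defines an open and closed set of
  enumerated groups, and each of the properties is shown to be an intersection of conditions that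
  define closed sets. Since the enumerated groups form a closed subset of a countable product of
  countable discrete spaces, every closed set of them is Polish (\<open>polish_closed_subspace\<close>).

  For torsion-freeness and the unique product property the definitions already are such
  intersections. A left or two-sided order is an additional datum, but orders are points of the
  compact space of all relations, the requirements on the pair of group and order are closed, and
  projections along compact spaces are closed maps (\<open>closedin_Collect_bex_compact\<close>).

  Local indicability is treated by the same projection. A finitely generated group maps onto the
  integers if and only if it has a nonzero homomorphism to the reals, as one sees by composing with
  a rational functional on the reals and clearing denominators. Such a homomorphism is determined by
  its values on a finite symmetric generating set \<open>S\<close>, and after scaling these form a point of a
  compact cube with largest coordinate one in absolute value. The remaining condition, that words
  with equal value have equal weight, is closed (\<open>locally_indicable_iff\<close>).

  For soficity the point is that the existence of approximations does not depend on the generating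
  set: an approximation of high quality for one set yields one for another set by reading words in
  the old generators as single edges (\<open>cayley_approximations_generate\<close>). Hence a group is sofic if
  and only if for every finite symmetric subset \<open>S\<close> and every \<open>n > 1\<close> there is an
  \<open>n\<close>-approximation (\<open>sofic_iff\<close>), and whether there is one depends only on the ball of
  radius \<open>n\<close> around the identity with respect to \<open>S\<close>, which is locally constant.
\<close>

section \<open>Locally constant functions and closed sets\<close>

text \<open>Local constancy is used instead of continuity into a discrete space because it needs no choice of
target, so that predicates, group elements, finite sets of them and finite graphs are all handled
by the same rules.\<close>

definition locally_constant :: "'a topology \<Rightarrow> ('a \<Rightarrow> 'b) \<Rightarrow> bool" where
  "locally_constant X f \<longleftrightarrow>
     (\<forall>x\<in>topspace X. \<exists>U. openin X U \<and> x \<in> U \<and> f constant_on U)"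

lemma locally_constantI:
  assumes "\<And>x. x \<in> topspace X \<Longrightarrow> \<exists>U a. openin X U \<and> x \<in> U \<and> (\<forall>y\<in>U. f y = a)"
  shows "locally_constant X f"
  using assms by (simp add: locally_constant_def constant_on_def)

lemma locally_constantE:
  assumes "locally_constant X f" "x \<in> topspace X"
  obtains U a where "openin X U" "x \<in> U" "\<forall>y\<in>U. f y = a"
proof -
  have "\<exists>U. openin X U \<and> x \<in> U \<and> f constant_on U"
    using assms by (simp add: locally_constant_def)
  then show ?thesis
    using that by (auto simp: constant_on_def)
qed

lemma locally_constant_const [simp]: "locally_constant X (\<lambda>x. a)"
  by (rule locally_constantI) (intro exI[of _ "topspace X"] exI[of _ a], simp)

text \<open>Near \<open>x\<close> the value of \<open>f\<close> is frozen, so a quantity computed from it only has to be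
locally constant for that one value. This is what makes iterated multiplications locally constant:
the product of two elements that depend on the point is read off a fixed entry of the
multiplication table nearby.\<close>

lemma locally_constant_bind:
  assumes f: "locally_constant X f"
    and g: "\<And>x. x \<in> topspace X \<Longrightarrow> locally_constant X (g (f x))"
  shows "locally_constant X (\<lambda>x. g (f x) x)"
proof (rule locally_constantI)
  fix x assume x: "x \<in> topspace X"
  obtain U a where U: "openin X U" "x \<in> U" "\<And>y. y \<in> U \<Longrightarrow> f y = a"
    using locally_constantE[OF f x] by metis
  obtain V b where V: "openin X V" "x \<in> V" "\<And>y. y \<in> V \<Longrightarrow> g (f x) y = b"
    using locally_constantE[OF g[OF x] x] by metis
  have "openin X (U \<inter> V) \<and> x \<in> U \<inter> V \<and> (\<forall>y\<in>U \<inter> V. g (f y) y = b)"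
    using U V by auto
  then show "\<exists>U b. openin X U \<and> x \<in> U \<and> (\<forall>y\<in>U. g (f y) y = b)"
    by blast
qed

lemma locally_constant_apply:
  "locally_constant X f \<Longrightarrow> locally_constant X (\<lambda>x. F (f x))"
  using locally_constant_bind[of X f "\<lambda>a _. F a"] by simp

lemma locally_constant_apply2:
  assumes "locally_constant X f" "locally_constant X g"
  shows "locally_constant X (\<lambda>x. F (f x) (g x))"
  by (rule locally_constant_bind[OF assms(1), of "\<lambda>a x. F a (g x)"])
    (rule locally_constant_apply[OF assms(2)])

lemma locally_constant_restrict:
  assumes "finite A" "\<And>a. a \<in> A \<Longrightarrow> locally_constant X (h a)"
  shows "locally_constant X (\<lambda>x. restrict (\<lambda>a. h a x) A)"
  using assms
proof (induction A rule: finite_induct)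
  case empty
  then show ?case by simp
next
  case (insert a A)
  have "locally_constant X (\<lambda>x. (restrict (\<lambda>a. h a x) A)(a := h a x))"
    by (rule locally_constant_apply2[where F = "\<lambda>r b. r(a := b)"])
      (use insert.IH insert.prems in blast)+
  moreover have "(restrict (\<lambda>a. h a x) A)(a := h a x) = restrict (\<lambda>a. h a x) (insert a A)" for x
    by (auto simp: fun_eq_iff restrict_def)
  ultimately show ?case by (simp only:)
qed

lemma locally_constant_image:
  assumes "finite A" "\<And>a. a \<in> A \<Longrightarrow> locally_constant X (h a)"
  shows "locally_constant X (\<lambda>x. (\<lambda>a. h a x) ` A)"
proof -
  have "(\<lambda>a. h a x) ` A = restrict (\<lambda>a. h a x) A ` A" for x
    by auto
  then show ?thesis
    using locally_constant_apply[OF locally_constant_restrict[OF assms], where F = "\<lambda>r. r ` A"]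
    by simp
qed

lemma locally_constant_Ball:
  assumes "finite A" "\<And>a. a \<in> A \<Longrightarrow> locally_constant X (P a)"
  shows "locally_constant X (\<lambda>x. \<forall>a\<in>A. P a x)"
  using locally_constant_apply[OF locally_constant_image[OF assms], where F = "\<lambda>B. False \<notin> B"]
  by (simp add: image_iff Ball_def)

lemma locally_constant_Bex:
  assumes "finite A" "\<And>a. a \<in> A \<Longrightarrow> locally_constant X (P a)"
  shows "locally_constant X (\<lambda>x. \<exists>a\<in>A. P a x)"
  using locally_constant_apply[OF locally_constant_image[OF assms], where F = "\<lambda>B. True \<in> B"]
  by (simp add: image_iff Bex_def)

lemma locally_constant_cong:
  assumes "\<And>x. x \<in> topspace X \<Longrightarrow> f x = g x"
  shows "locally_constant X f \<longleftrightarrow> locally_constant X g"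
proof -
  have "f constant_on U \<longleftrightarrow> g constant_on U" if "openin X U" for U
    using openin_subset[OF that] assms by (auto simp: constant_on_def subset_iff)
  then show ?thesis
    unfolding locally_constant_def by blast
qed

lemma locally_constant_compose:
  assumes "locally_constant Y f" "continuous_map X Y p"
  shows "locally_constant X (\<lambda>x. f (p x))"
proof (rule locally_constantI)
  fix x assume x: "x \<in> topspace X"
  then have "p x \<in> topspace Y"
    using assms(2) by (auto simp: continuous_map_def)
  then obtain U a where U: "openin Y U" "p x \<in> U" "\<And>y. y \<in> U \<Longrightarrow> f y = a"
    using locally_constantE[OF assms(1)] by metis
  show "\<exists>U a. openin X U \<and> x \<in> U \<and> (\<forall>y\<in>U. f (p y) = a)"
    using U x openin_continuous_map_preimage[OF assms(2) U(1)]
    by (intro exI[of _ "{x \<in> topspace X. p x \<in> U}"] exI[of _ a]) auto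
qed

lemma continuous_map_discrete_imp_locally_constant:
  assumes "continuous_map X (discrete_topology A) f"
  shows "locally_constant X f"
proof -
  have "locally_constant (discrete_topology A) id"
  proof (rule locally_constantI)
    show "\<exists>U a. openin (discrete_topology A) U \<and> x \<in> U \<and> (\<forall>y\<in>U. id y = a)"
      if "x \<in> topspace (discrete_topology A)" for x
      using that by (intro exI[of _ "{x}"] exI[of _ x]) auto
  qed
  from locally_constant_compose[OF this assms] show ?thesis by simp
qed

lemma closedin_locally_constant:
  assumes "locally_constant X P"
  shows "closedin X {x \<in> topspace X. P x}"
  unfolding closedin_def
proof
  show "openin X (topspace X - {x \<in> topspace X. P x})"
  proof (subst openin_subopen, intro ballI)
    fix x assume x: "x \<in> topspace X - {x \<in> topspace X. P x}"
    then have "x \<in> topspace X" by simp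
    then obtain U a where U: "openin X U" "x \<in> U" "\<And>y. y \<in> U \<Longrightarrow> P y = a"
      using locally_constantE[OF assms] by metis
    have "\<not> a"
      using U(3)[OF U(2)] x by simp
    then show "\<exists>T. openin X T \<and> x \<in> T \<and> T \<subseteq> topspace X - {x \<in> topspace X. P x}"
      using U openin_subset[OF U(1)] by (intro exI[of _ U]) auto
  qed
qed auto

lemma closedin_Collect_all:
  assumes "\<And>i. closedin X {x \<in> topspace X. Q i x}"
  shows "closedin X {x \<in> topspace X. \<forall>i. Q i x}"
proof -
  have "{x \<in> topspace X. \<forall>i. Q i x} = (\<Inter>i. {x \<in> topspace X. Q i x})"
    by auto
  then show ?thesis
    using assms by (simp add: closedin_INT)
qed

lemma closedin_Collect_ball:
  assumes "\<And>i. i \<in> I \<Longrightarrow> closedin X {x \<in> topspace X. Q i x}"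
  shows "closedin X {x \<in> topspace X. \<forall>i\<in>I. Q i x}"
proof (cases "I = {}")
  case False
  then have "{x \<in> topspace X. \<forall>i\<in>I. Q i x} = (\<Inter>i\<in>I. {x \<in> topspace X. Q i x})"
    by auto
  then show ?thesis
    using assms False by (simp add: closedin_INT)
qed auto

lemma closedin_Collect_conj:
  assumes "closedin X {x \<in> topspace X. P x}" "closedin X {x \<in> topspace X. Q x}"
  shows "closedin X {x \<in> topspace X. P x \<and> Q x}"
proof -
  have "{x \<in> topspace X. P x \<and> Q x} = {x \<in> topspace X. P x} \<inter> {x \<in> topspace X. Q x}"
    by auto
  then show ?thesis using assms by (simp add: closedin_Int)
qed

lemma closedin_Collect_disj:
  assumes "closedin X {x \<in> topspace X. P x}" "closedin X {x \<in> topspace X. Q x}"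
  shows "closedin X {x \<in> topspace X. P x \<or> Q x}"
proof -
  have "{x \<in> topspace X. P x \<or> Q x} = {x \<in> topspace X. P x} \<union> {x \<in> topspace X. Q x}"
    by auto
  then show ?thesis using assms by (simp add: closedin_Un)
qed

lemma closedin_Collect_imp:
  assumes "P \<Longrightarrow> closedin X {x \<in> topspace X. Q x}"
  shows "closedin X {x \<in> topspace X. P \<longrightarrow> Q x}"
  using assms by (cases P) auto

lemma closedin_Collect_locally_constant_imp:
  assumes "locally_constant X P" "closedin X {x \<in> topspace X. Q x}"
  shows "closedin X {x \<in> topspace X. P x \<longrightarrow> Q x}"
  unfolding imp_conv_disj
  by (intro closedin_Collect_disj closedin_locally_constant locally_constant_apply[where F = Not] assms)

text \<open>Existential statements with a witness in a compact space remain closed: the set is a projection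
along a compact factor, and such projections are closed maps.\<close>

lemma closedin_Collect_bex_compact:
  assumes K: "compact_space K"
    and Q: "closedin (prod_topology X K) {z \<in> topspace (prod_topology X K). Q (fst z) (snd z)}"
  shows "closedin X {x \<in> topspace X. \<exists>k\<in>topspace K. Q x k}"
proof -
  have "{x \<in> topspace X. \<exists>k\<in>topspace K. Q x k} =
      fst ` {z \<in> topspace (prod_topology X K). Q (fst z) (snd z)}"
    by (force simp: image_iff)
  then show ?thesis
    using closed_map_fst[OF K, of X] Q by (simp add: closed_map_def)
qed

section \<open>Second countability of products\<close>

lemma second_countable_prod_topology:
  assumes "second_countable X" "second_countable Y"
  shows "second_countable (prod_topology X Y)"
proof -
  obtain \<A> where \<A>: "countable \<A>" "\<And>V. V \<in> \<A> \<Longrightarrow> openin X V"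
    "\<And>U x. openin X U \<Longrightarrow> x \<in> U \<Longrightarrow> \<exists>V\<in>\<A>. x \<in> V \<and> V \<subseteq> U"
    using assms(1) unfolding second_countable_def by metis
  obtain \<B> where \<B>: "countable \<B>" "\<And>V. V \<in> \<B> \<Longrightarrow> openin Y V"
    "\<And>U x. openin Y U \<Longrightarrow> x \<in> U \<Longrightarrow> \<exists>V\<in>\<B>. x \<in> V \<and> V \<subseteq> U"
    using assms(2) unfolding second_countable_def by metis
  show ?thesis
    unfolding second_countable_def
  proof (intro exI conjI ballI allI impI)
    show "countable ((\<lambda>(V, W). V \<times> W) ` (\<A> \<times> \<B>))"
      using \<A>(1) \<B>(1) by simp
    show "openin (prod_topology X Y) V" if "V \<in> (\<lambda>(V, W). V \<times> W) ` (\<A> \<times> \<B>)" for V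
      using that \<A>(2) \<B>(2) by (auto simp: openin_prod_Times_iff)
    show "\<exists>V\<in>(\<lambda>(V, W). V \<times> W) ` (\<A> \<times> \<B>). z \<in> V \<and> V \<subseteq> U"
      if Uz: "openin (prod_topology X Y) U \<and> z \<in> U" for U z
    proof -
      obtain x y where z: "z = (x, y)" by fastforce
      obtain V W where VW: "openin X V" "openin Y W" "x \<in> V" "y \<in> W" "V \<times> W \<subseteq> U"
        using Uz z openin_prod_topology_alt[THEN iffD1, rule_format, of X Y U x y] by auto
      obtain V' where V': "V' \<in> \<A>" "x \<in> V'" "V' \<subseteq> V" using \<A>(3) VW by meson
      obtain W' where W': "W' \<in> \<B>" "y \<in> W'" "W' \<subseteq> W" using \<B>(3) VW by meson
      show ?thesis
        using V' W' VW z by (intro bexI[of _ "V' \<times> W'"]) auto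
    qed
  qed
qed

text \<open>A basis is formed by the cylinders that prescribe finitely many coordinates; with a countable
index set and a countable alphabet there are only countably many of them.\<close>

lemma second_countable_product_discrete:
  fixes A :: "'b set" and I :: "'a set"
  assumes "countable A" "countable I"
  shows "second_countable (product_topology (\<lambda>_. discrete_topology A) I)"
proof -
  let ?X = "product_topology (\<lambda>_. discrete_topology A) I"
  let ?\<F> = "{F. finite F \<and> F \<subseteq> I \<times> A}"
  let ?C = "\<lambda>F. {x \<in> topspace ?X. \<forall>(i, a)\<in>F. x i = a}"
  have cyl: "openin ?X (?C F)" if F: "F \<in> ?\<F>" for F
  proof -
    have proj: "openin ?X {x \<in> topspace ?X. x i = a}" if "(i, a) \<in> F" for i a
    proof -
      have "openin (discrete_topology A) {a}" "i \<in> I"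
        using F that by auto
      then show ?thesis
        using openin_continuous_map_preimage[OF continuous_map_product_projection[of i I "\<lambda>_. discrete_topology A"],
            of "{a}"] by simp
    qed
    have "?C F = topspace ?X \<inter> (\<Inter>(i, a)\<in>F. {x \<in> topspace ?X. x i = a})"
      by auto
    moreover have "openin ?X (topspace ?X \<inter> (\<Inter>(i, a)\<in>F. {x \<in> topspace ?X. x i = a}))"
    proof (cases "F = {}")
      case False
      then show ?thesis
        using F proj by (intro openin_Int openin_INT openin_topspace) auto
    qed (use openin_topspace[of ?X] in simp)
    ultimately show ?thesis by simp
  qed
  show ?thesis
    unfolding second_countable_def
  proof (intro exI conjI ballI allI impI)
    show "countable (?C ` ?\<F>)"
      using assms by (intro countable_image countable_Collect_finite_subset countable_SIGMA) auto
    show "openin ?X V" if "V \<in> ?C ` ?\<F>" for V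
      using that cyl by auto
    show "\<exists>V\<in>?C ` ?\<F>. x \<in> V \<and> V \<subseteq> U" if Ux: "openin ?X U \<and> x \<in> U" for U x
    proof -
      obtain Z where Z: "x \<in> (\<Pi>\<^sub>E i\<in>I. Z i)" "finite {i. Z i \<noteq> A}" "(\<Pi>\<^sub>E i\<in>I. Z i) \<subseteq> U"
        using product_topology_open_contains_basis[of "\<lambda>_. discrete_topology A" I U x] Ux
        by auto
      define F where "F = (\<lambda>i. (i, x i)) ` {i\<in>I. Z i \<noteq> A}"
      have x: "x \<in> topspace ?X"
        using Ux openin_subset by blast
      have "F \<in> ?\<F>"
        using Z(2) x by (auto simp: F_def PiE_iff)
      moreover have "x \<in> ?C F"
        using x by (auto simp: F_def)
      moreover have "?C F \<subseteq> U"
      proof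
        fix y assume y: "y \<in> ?C F"
        have "y \<in> (\<Pi>\<^sub>E i\<in>I. Z i)"
          unfolding PiE_iff
        proof
          show "\<forall>i\<in>I. y i \<in> Z i"
          proof
            fix i assume i: "i \<in> I"
            show "y i \<in> Z i"
            proof (cases "Z i = A")
              case True
              then show ?thesis using y i by (auto simp: PiE_iff)
            next
              case False
              then have "y i = x i" using y i by (auto simp: F_def)
              then show ?thesis using Z(1) i by (simp add: PiE_iff)
            qed
          qed
          show "y \<in> extensional I" using y by (auto simp: PiE_iff)
        qed
        then show "y \<in> U" using Z(3) by blast
      qed
      ultimately show ?thesis
        by (intro bexI[of _ "?C F"] conjI imageI)
    qed
  qed
qed

section \<open>The space of enumerated groups is Polish\<close>

text \<open>Membership in \<^term>\<open>Pos\<close> serves below as an opaque carrier condition; the two simplification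
rules that would unfold it are switched off.\<close>

declare One_nat_def [simp del] atLeast_iff [iff del]

lemma topspace_enumerated_group_space [simp]:
  "topspace enumerated_group_space = enumerated_groups"
  by (auto simp: enumerated_group_space_def enumerated_groups_def)

lemma carrier_coded_monoid [simp]: "carrier (coded_monoid c) = Pos"
  by (simp add: coded_monoid_def split: prod.split)

lemma coded_monoid_simps [simp]:
  "x \<otimes>\<^bsub>coded_monoid (m, i, e)\<^esub> y = m (x, y)" "\<one>\<^bsub>coded_monoid (m, i, e)\<^esub> = e"
  by (simp_all add: coded_monoid_def)

lemma group_coded_monoid: "c \<in> enumerated_groups \<Longrightarrow> group (coded_monoid c)"
  by (auto simp: enumerated_groups_def)

lemma continuous_map_code:
  shows "continuous_map code_topology (discrete_topology Pos) (\<lambda>c. snd (snd c))"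
    and "x \<in> Pos \<Longrightarrow> y \<in> Pos \<Longrightarrow>
      continuous_map code_topology (discrete_topology Pos) (\<lambda>c. fst c (x, y))"
    and "x \<in> Pos \<Longrightarrow>
      continuous_map code_topology (discrete_topology Pos) (\<lambda>c. fst (snd c) x)"
proof -
  show "continuous_map code_topology (discrete_topology Pos) (\<lambda>c. snd (snd c))"
    unfolding code_topology_def
    by (rule continuous_map_compose[OF continuous_map_snd continuous_map_snd, unfolded o_def])
  show "continuous_map code_topology (discrete_topology Pos) (\<lambda>c. fst c (x, y))"
    if "x \<in> Pos" "y \<in> Pos"
    unfolding code_topology_def
    by (rule continuous_map_compose[OF continuous_map_fst continuous_map_product_projection, unfolded o_def])
      (use that in auto)
  have fst_snd: "continuous_map code_topology (product_topology (\<lambda>_. discrete_topology Pos) Pos)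
      (\<lambda>c. fst (snd c))"
    unfolding code_topology_def
    by (rule continuous_map_compose[OF continuous_map_snd continuous_map_fst, unfolded o_def])
  show "continuous_map code_topology (discrete_topology Pos) (\<lambda>c. fst (snd c) x)"
    if "x \<in> Pos"
    by (rule continuous_map_compose[OF fst_snd continuous_map_product_projection[OF that], unfolded o_def])
qed

lemmas locally_constant_code =
  continuous_map_code[THEN continuous_map_discrete_imp_locally_constant]

lemma topspace_code_topology:
  "(m, i, e) \<in> topspace code_topology \<longleftrightarrow>
     m \<in> (Pos \<times> Pos \<rightarrow>\<^sub>E Pos) \<and> i \<in> (Pos \<rightarrow>\<^sub>E Pos) \<and> e \<in> Pos"
  by (simp add: code_topology_def)

text \<open>The group axioms are a conjunction of equations between entries of the tables, one for each
choice of elements; this form shows that the enumerated groups form a closed set.\<close>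

lemma enumerated_groups_iff:
  "c \<in> enumerated_groups \<longleftrightarrow> c \<in> topspace code_topology \<and>
     (\<forall>x\<in>Pos. \<forall>y\<in>Pos. \<forall>z\<in>Pos. fst c (fst c (x, y), z) = fst c (x, fst c (y, z))) \<and>
     (\<forall>x\<in>Pos. fst c (snd (snd c), x) = x \<and> fst c (fst (snd c) x, x) = snd (snd c))"
  (is "?L \<longleftrightarrow> ?R")
proof (cases c)
  case (fields m i e)
  let ?G = "coded_monoid (m, i, e)"
  show ?thesis
  proof
    assume L: ?L
    then interpret group ?G
      using group_coded_monoid fields by blast
    from L fields have *: "(m, i, e) \<in> topspace code_topology" "\<forall>x\<in>Pos. i x = inv\<^bsub>?G\<^esub> x"
      by (auto simp: enumerated_groups_def)
    show ?R
      using * m_assoc l_one l_inv fields by auto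
  next
    assume R: ?R
    then have *: "m (x, y) \<in> Pos" "i x \<in> Pos" if "x \<in> Pos" "y \<in> Pos" for x y
      using that fields by (auto simp: topspace_code_topology PiE_iff)
    have e: "e \<in> Pos"
      using R fields by (simp add: topspace_code_topology)
    have "group ?G"
    proof (rule groupI)
      show "\<exists>y\<in>carrier ?G. y \<otimes>\<^bsub>?G\<^esub> x = \<one>\<^bsub>?G\<^esub>" if "x \<in> carrier ?G" for x
        using that R fields *(2)[of x x] by (intro bexI[of _ "i x"]) auto
    qed (use R fields e *(1) in auto)
    then interpret group ?G .
    have "i x = inv\<^bsub>?G\<^esub> x" if "x \<in> Pos" for x
      using inv_equality[of "i x" x] that R fields *(2)[of x x] by simp
    then show ?L
      using R fields \<open>group ?G\<close> by (auto simp: enumerated_groups_def)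
  qed
qed

lemma code_mult_closed:
  assumes "c \<in> topspace code_topology" "x \<in> Pos" "y \<in> Pos"
  shows "fst c (x, y) \<in> Pos" "fst (snd c) x \<in> Pos" "snd (snd c) \<in> Pos"
  using assms by (cases c, auto simp: topspace_code_topology PiE_iff)+

lemma locally_constant_code_mult:
  assumes "locally_constant code_topology f" "locally_constant code_topology g"
    and "\<And>c. c \<in> topspace code_topology \<Longrightarrow> f c \<in> Pos"
    and "\<And>c. c \<in> topspace code_topology \<Longrightarrow> g c \<in> Pos"
  shows "locally_constant code_topology (\<lambda>c. fst c (f c, g c))"
  by (rule locally_constant_bind[where f = "\<lambda>c. (f c, g c)" and g = "\<lambda>p c. fst c p",
        OF locally_constant_apply2[where F = Pair, OF assms(1,2)] locally_constant_code(2)[OF assms(3,4)]])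

lemma closedin_enumerated_groups: "closedin code_topology enumerated_groups"
proof -
  have "enumerated_groups = {c \<in> topspace code_topology.
     (\<forall>x\<in>Pos. \<forall>y\<in>Pos. \<forall>z\<in>Pos. fst c (fst c (x, y), z) = fst c (x, fst c (y, z))) \<and>
     (\<forall>x\<in>Pos. fst c (snd (snd c), x) = x \<and> fst c (fst (snd c) x, x) = snd (snd c))}"
    using enumerated_groups_iff by blast
  moreover have "closedin code_topology \<dots>"
    by (intro closedin_Collect_conj closedin_Collect_ball closedin_locally_constant
      locally_constant_apply2[where F = "(=)"] locally_constant_code_mult locally_constant_code locally_constant_const)
      (auto simp: code_mult_closed)
  ultimately show ?thesis by simp
qed

lemma polish_closed_subspace:
  assumes "closedin enumerated_group_space A"
  shows "polish_topology (subtopology enumerated_group_space A)"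
proof -
  have cm: "completely_metrizable_space code_topology"
    by (simp add: code_topology_def completely_metrizable_space_prod_topology
        completely_metrizable_space_product_topology completely_metrizable_space_discrete_topology)
  have sc: "second_countable code_topology"
    unfolding code_topology_def
    by (intro second_countable_prod_topology second_countable_product_discrete)
      (auto simp: second_countable_discrete_topology)
  show ?thesis
    unfolding polish_topology_def
  proof
    show "completely_metrizable_space (subtopology enumerated_group_space A)"
      using completely_metrizable_space_closedin[OF completely_metrizable_space_closedin[OF cm
            closedin_enumerated_groups]] assms
      by (simp add: enumerated_group_space_def)
    show "separable_space (subtopology enumerated_group_space A)"
      unfolding enumerated_group_space_def
      by (intro second_countable_imp_separable_space second_countable_subtopology sc)
  qed
qed

lemma locally_constant_one:
  "locally_constant enumerated_group_space (\<lambda>c. \<one>\<^bsub>coded_monoid c\<^esub>)"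
proof -
  have "locally_constant enumerated_group_space (\<lambda>c. snd (snd c))"
    unfolding enumerated_group_space_def
    by (rule locally_constant_compose[OF locally_constant_code(1)]) auto
  moreover have "\<one>\<^bsub>coded_monoid c\<^esub> = snd (snd c)" for c
    by (cases c) simp
  ultimately show ?thesis by simp
qed

lemma locally_constant_mult:
  assumes "locally_constant enumerated_group_space f" "locally_constant enumerated_group_space g"
    and "\<And>c. c \<in> enumerated_groups \<Longrightarrow> f c \<in> Pos" "\<And>c. c \<in> enumerated_groups \<Longrightarrow> g c \<in> Pos"
  shows "locally_constant enumerated_group_space (\<lambda>c. f c \<otimes>\<^bsub>coded_monoid c\<^esub> g c)"
proof -
  have mult: "x \<otimes>\<^bsub>coded_monoid c\<^esub> y = fst c (x, y)" for x y c
    by (cases c) simp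
  have "locally_constant enumerated_group_space (\<lambda>c. fst c (x, y))" if "x \<in> Pos" "y \<in> Pos" for x y
    unfolding enumerated_group_space_def
    by (rule locally_constant_compose[OF locally_constant_code(2)]) (use that in auto)
  then show ?thesis
    unfolding mult using assms(3,4)
    by (intro locally_constant_bind[where f = "\<lambda>c. (f c, g c)" and g = "\<lambda>p c. fst c p",
        OF locally_constant_apply2[where F = Pair, OF assms(1,2)]]) simp
qed

lemma locally_constant_inv:
  assumes "x \<in> Pos"
  shows "locally_constant enumerated_group_space (\<lambda>c. inv\<^bsub>coded_monoid c\<^esub> x)"
proof -
  have "locally_constant enumerated_group_space (\<lambda>c. fst (snd c) x)"
    unfolding enumerated_group_space_def
    by (rule locally_constant_compose[OF locally_constant_code(3)]) (use assms in auto)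
  moreover have "inv\<^bsub>coded_monoid c\<^esub> x = fst (snd c) x" if "c \<in> enumerated_groups" for c
    using that assms by (auto simp: enumerated_groups_def)
  ultimately show ?thesis
    using locally_constant_cong[of enumerated_group_space "\<lambda>c. inv\<^bsub>coded_monoid c\<^esub> x"] by simp
qed

section \<open>Torsion-freeness and the unique product property\<close>

text \<open>For fixed \<open>x\<close> and \<open>n\<close> the condition involves the powers of \<open>x\<close> up to \<open>n\<close>, which are
locally constant.\<close>

lemma closedin_torsion_free:
  "closedin enumerated_group_space {c \<in> enumerated_groups. torsion_free (coded_monoid c)}"
proof -
  have pow: "locally_constant enumerated_group_space (\<lambda>c. x [^]\<^bsub>coded_monoid c\<^esub> n)"
    if "x \<in> Pos" for x and n :: nat
  proof (induction n)
    case 0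
    then show ?case by (simp add: locally_constant_one)
  next
    case (Suc n)
    have "x [^]\<^bsub>coded_monoid c\<^esub> n \<in> Pos" if "c \<in> enumerated_groups" for c
      using monoid.nat_pow_closed[OF group.is_monoid[OF group_coded_monoid[OF that]], of x n] \<open>x \<in> Pos\<close>
      by simp
    then show ?case
      using locally_constant_mult[OF Suc locally_constant_const[of _ x]] that by simp
  qed
  have "closedin enumerated_group_space {c \<in> topspace enumerated_group_space.
     \<forall>x\<in>Pos. \<forall>n::nat. n > 0 \<and> x [^]\<^bsub>coded_monoid c\<^esub> n = \<one>\<^bsub>coded_monoid c\<^esub> \<longrightarrow> x = \<one>\<^bsub>coded_monoid c\<^esub>}"
  proof (intro closedin_Collect_ball closedin_Collect_all closedin_locally_constant)
    fix x :: nat and n :: nat assume "x \<in> Pos"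
    show "locally_constant enumerated_group_space
      (\<lambda>c. n > 0 \<and> x [^]\<^bsub>coded_monoid c\<^esub> n = \<one>\<^bsub>coded_monoid c\<^esub> \<longrightarrow> x = \<one>\<^bsub>coded_monoid c\<^esub>)"
      by (rule locally_constant_apply2[OF pow[OF \<open>x \<in> Pos\<close>] locally_constant_one,
            where F = "\<lambda>p e. n > 0 \<and> p = e \<longrightarrow> x = e"])
  qed
  then show ?thesis
    by (simp add: torsion_free_def)
qed

text \<open>For fixed finite \<open>X\<close> and \<open>Y\<close> the condition depends only on the finitely many products
of their elements.\<close>

lemma closedin_unique_product_property:
  "closedin enumerated_group_space {c \<in> enumerated_groups. unique_product_property (coded_monoid c)}"
proof -
  let ?U = "\<lambda>X Y c. \<exists>x\<in>X. \<exists>y\<in>Y. \<forall>x'\<in>X - {x}. \<forall>y'\<in>Y - {y}.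
    x \<otimes>\<^bsub>coded_monoid c\<^esub> y \<noteq> x' \<otimes>\<^bsub>coded_monoid c\<^esub> y'"
  let ?A = "\<lambda>X Y. finite X \<and> X \<noteq> {} \<and> X \<subseteq> Pos \<and> finite Y \<and> Y \<noteq> {} \<and> Y \<subseteq> Pos"
  have "unique_product_property (coded_monoid c) \<longleftrightarrow> (\<forall>X Y. ?A X Y \<longrightarrow> ?U X Y c)"
    if "c \<in> enumerated_groups" for c
  proof -
    interpret group "coded_monoid c" using group_coded_monoid[OF that] .
    have "(\<exists>g\<in>Pos. \<exists>x\<in>X. \<exists>y\<in>Y. g = x \<otimes>\<^bsub>coded_monoid c\<^esub> y \<and>
           (\<forall>x'\<in>X - {x}. \<forall>y'\<in>Y - {y}. g \<noteq> x' \<otimes>\<^bsub>coded_monoid c\<^esub> y')) \<longleftrightarrow> ?U X Y c"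
      if "?A X Y" for X Y
    proof -
      have "x \<otimes>\<^bsub>coded_monoid c\<^esub> y \<in> Pos" if "x \<in> X" "y \<in> Y" for x y
        using that \<open>?A X Y\<close> m_closed[of x y] by auto
      then show ?thesis by auto
    qed
    then show ?thesis
      by (simp add: unique_product_property_def)
  qed
  then have "{c \<in> enumerated_groups. unique_product_property (coded_monoid c)} =
      {c \<in> topspace enumerated_group_space. \<forall>X Y. ?A X Y \<longrightarrow> ?U X Y c}"
    unfolding topspace_enumerated_group_space by (intro Collect_cong conj_cong refl)
  moreover have "closedin enumerated_group_space \<dots>"
  proof (intro closedin_Collect_all)
    fix X Y :: "nat set"
    show "closedin enumerated_group_space
      {c \<in> topspace enumerated_group_space. ?A X Y \<longrightarrow> ?U X Y c}"
    proof (rule closedin_Collect_imp)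
      assume XY: "?A X Y"
      then have "locally_constant enumerated_group_space (\<lambda>c. x \<otimes>\<^bsub>coded_monoid c\<^esub> y)"
        if "x \<in> X" "y \<in> Y" for x y
        using that by (intro locally_constant_mult) auto
      then have "locally_constant enumerated_group_space (?U X Y)"
        using XY by (intro locally_constant_Ball locally_constant_Bex
            locally_constant_apply2[where F = "(\<noteq>)"]) auto
      then show "closedin enumerated_group_space {c \<in> topspace enumerated_group_space. ?U X Y c}"
        by (rule closedin_locally_constant)
    qed
  qed
  ultimately show ?thesis by simp
qed

section \<open>Orderability\<close>

text \<open>The compact space from which the candidates for an order are taken: all relations on the natural
numbers, encoded by their characteristic functions.\<close>

definition relation_space :: "(nat \<times> nat \<Rightarrow> bool) topology" where
  "relation_space = product_topology (\<lambda>_. discrete_topology UNIV) UNIV"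

lemma topspace_relation_space [simp]: "topspace relation_space = UNIV"
  by (simp add: relation_space_def)

lemma compact_relation_space: "compact_space relation_space"
  by (simp add: relation_space_def compact_space_product_topology compact_space_discrete_topology)

lemma locally_constant_relation:
  "locally_constant (prod_topology X relation_space) (\<lambda>z. snd z p)"
proof (rule continuous_map_discrete_imp_locally_constant)
  show "continuous_map (prod_topology X relation_space) (discrete_topology UNIV) (\<lambda>z. snd z p)"
    unfolding relation_space_def
    by (rule continuous_map_compose[OF continuous_map_snd continuous_map_product_projection,
          unfolded o_def]) simp
qed

lemma closedin_linear_order:
  "closedin (prod_topology X relation_space)
     {z \<in> topspace (prod_topology X relation_space). linear_order_on A (Collect (snd z))}"
proof -
  have *: "linear_order_on A (Collect \<rho>) \<longleftrightarrow>
      (\<forall>x y. \<rho> (x, y) \<longrightarrow> x \<in> A \<and> y \<in> A) \<and> (\<forall>x\<in>A. \<rho> (x, x)) \<and>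
      (\<forall>x y z. \<rho> (x, y) \<longrightarrow> \<rho> (y, z) \<longrightarrow> \<rho> (x, z)) \<and>
      (\<forall>x y. \<rho> (x, y) \<longrightarrow> \<rho> (y, x) \<longrightarrow> x = y) \<and>
      (\<forall>x\<in>A. \<forall>y\<in>A. x \<noteq> y \<longrightarrow> \<rho> (x, y) \<or> \<rho> (y, x))" for \<rho> and A :: "nat set"
  proof -
    have "Collect \<rho> \<subseteq> A \<times> A \<longleftrightarrow> (\<forall>x y. \<rho> (x, y) \<longrightarrow> x \<in> A \<and> y \<in> A)"
      by auto
    then show ?thesis
      by (simp only: order_on_defs refl_on_def trans_def antisym_def total_on_def mem_Collect_eq
          conj_assoc)
  qed
  note lc = locally_constant_relation[of X]
  show ?thesis
    unfolding *
    by (intro closedin_Collect_conj closedin_Collect_all closedin_Collect_ball closedin_locally_constant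
      locally_constant_apply2[where F = "(\<and>)"] locally_constant_apply2[where F = "(\<or>)"]
      locally_constant_apply2[where F = "(\<longrightarrow>)"] lc locally_constant_const)
qed

lemma locally_constant_relation_mult:
  assumes "a \<in> Pos" "b \<in> Pos" "c \<in> Pos" "d \<in> Pos"
  shows "locally_constant (prod_topology enumerated_group_space relation_space)
    (\<lambda>z. snd z (a \<otimes>\<^bsub>coded_monoid (fst z)\<^esub> b, c \<otimes>\<^bsub>coded_monoid (fst z)\<^esub> d))"
proof (rule locally_constant_bind[where g = "\<lambda>p z. snd z p"])
  have "locally_constant enumerated_group_space
      (\<lambda>k. (a \<otimes>\<^bsub>coded_monoid k\<^esub> b, c \<otimes>\<^bsub>coded_monoid k\<^esub> d))"
    using assms by (intro locally_constant_apply2[where F = Pair] locally_constant_mult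
        locally_constant_const)
  from locally_constant_compose[OF this continuous_map_fst]
  show "locally_constant (prod_topology enumerated_group_space relation_space)
    (\<lambda>z. (a \<otimes>\<^bsub>coded_monoid (fst z)\<^esub> b, c \<otimes>\<^bsub>coded_monoid (fst z)\<^esub> d))" .
qed (rule locally_constant_relation)

text \<open>Being an order with the property \<open>Q\<close> is a closed condition on pairs of a group and a
relation, and relations form a compact space, so the relation can be projected away.\<close>

lemma closedin_exists_order:
  assumes Q: "closedin (prod_topology enumerated_group_space relation_space)
      {z \<in> topspace (prod_topology enumerated_group_space relation_space).
        Q (fst z) (Collect (snd z))}"
  shows "closedin enumerated_group_space {c \<in> enumerated_groups. \<exists>r. linear_order_on Pos r \<and> Q c r}"
proof -
  have "(\<exists>r. linear_order_on Pos r \<and> Q c r) \<longleftrightarrow>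
      (\<exists>\<rho>\<in>topspace relation_space. linear_order_on Pos (Collect \<rho>) \<and> Q c (Collect \<rho>))" for c
    by (metis Collect_mem_eq UNIV_I topspace_relation_space)
  moreover have "closedin enumerated_group_space {c \<in> topspace enumerated_group_space.
      \<exists>\<rho>\<in>topspace relation_space. linear_order_on Pos (Collect \<rho>) \<and> Q c (Collect \<rho>)}"
    by (intro closedin_Collect_bex_compact compact_relation_space closedin_Collect_conj
        closedin_linear_order Q)
  ultimately show ?thesis by simp
qed

lemma closedin_invariant:
  "closedin (prod_topology enumerated_group_space relation_space)
     {z \<in> topspace (prod_topology enumerated_group_space relation_space).
       \<forall>g\<in>Pos. \<forall>x\<in>Pos. \<forall>y\<in>Pos. (x, y) \<in> Collect (snd z) \<longrightarrow>
         (g \<otimes>\<^bsub>coded_monoid (fst z)\<^esub> x, g \<otimes>\<^bsub>coded_monoid (fst z)\<^esub> y) \<in> Collect (snd z)}"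
  "closedin (prod_topology enumerated_group_space relation_space)
     {z \<in> topspace (prod_topology enumerated_group_space relation_space).
       \<forall>g\<in>Pos. \<forall>x\<in>Pos. \<forall>y\<in>Pos. (x, y) \<in> Collect (snd z) \<longrightarrow>
         (x \<otimes>\<^bsub>coded_monoid (fst z)\<^esub> g, y \<otimes>\<^bsub>coded_monoid (fst z)\<^esub> g) \<in> Collect (snd z)}"
  unfolding mem_Collect_eq
  by (intro closedin_Collect_ball closedin_locally_constant locally_constant_relation
      locally_constant_apply2[where F = "(\<longrightarrow>)"] locally_constant_relation_mult; assumption)+

text \<open>An order on the carrier relates only elements of the carrier. Restricting the quantifiers
accordingly makes each instance refer to entries of the multiplication table that vary locally
constantly.\<close>

lemma invariant_iff_on_carrier:
  assumes "r \<subseteq> carrier G \<times> carrier G"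
  shows "left_invariant G r \<longleftrightarrow> (\<forall>g\<in>carrier G. \<forall>x\<in>carrier G. \<forall>y\<in>carrier G.
      (x, y) \<in> r \<longrightarrow> (g \<otimes>\<^bsub>G\<^esub> x, g \<otimes>\<^bsub>G\<^esub> y) \<in> r)"
    and "right_invariant G r \<longleftrightarrow> (\<forall>g\<in>carrier G. \<forall>x\<in>carrier G. \<forall>y\<in>carrier G.
      (x, y) \<in> r \<longrightarrow> (x \<otimes>\<^bsub>G\<^esub> g, y \<otimes>\<^bsub>G\<^esub> g) \<in> r)"
  using assms unfolding left_invariant_def right_invariant_def by blast+

lemma linear_order_on_subset: "linear_order_on A r \<Longrightarrow> r \<subseteq> A \<times> A"
  by (simp add: order_on_defs)

lemma closedin_left_orderable:
  "closedin enumerated_group_space {c \<in> enumerated_groups. left_orderable (coded_monoid c)}"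
proof -
  have *: "left_orderable (coded_monoid c) \<longleftrightarrow> (\<exists>r. linear_order_on Pos r \<and>
      (\<forall>g\<in>Pos. \<forall>x\<in>Pos. \<forall>y\<in>Pos. (x, y) \<in> r \<longrightarrow>
        (g \<otimes>\<^bsub>coded_monoid c\<^esub> x, g \<otimes>\<^bsub>coded_monoid c\<^esub> y) \<in> r))" for c
    using invariant_iff_on_carrier(1)[of _ "coded_monoid c"] linear_order_on_subset[of Pos]
    by (simp add: left_orderable_def cong: conj_cong)
  show ?thesis
    unfolding * by (rule closedin_exists_order[OF closedin_invariant(1)])
qed

lemma closedin_biorderable:
  "closedin enumerated_group_space {c \<in> enumerated_groups. biorderable (coded_monoid c)}"
proof -
  have *: "biorderable (coded_monoid c) \<longleftrightarrow> (\<exists>r. linear_order_on Pos r \<and>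
      (\<forall>g\<in>Pos. \<forall>x\<in>Pos. \<forall>y\<in>Pos. (x, y) \<in> r \<longrightarrow>
        (g \<otimes>\<^bsub>coded_monoid c\<^esub> x, g \<otimes>\<^bsub>coded_monoid c\<^esub> y) \<in> r) \<and>
      (\<forall>g\<in>Pos. \<forall>x\<in>Pos. \<forall>y\<in>Pos. (x, y) \<in> r \<longrightarrow>
        (x \<otimes>\<^bsub>coded_monoid c\<^esub> g, y \<otimes>\<^bsub>coded_monoid c\<^esub> g) \<in> r))" for c
    using invariant_iff_on_carrier[of _ "coded_monoid c"] linear_order_on_subset[of Pos]
    by (simp add: biorderable_def cong: conj_cong)
  show ?thesis
    unfolding *
    by (rule closedin_exists_order[OF closedin_Collect_conj[OF closedin_invariant]])
qed

section \<open>Words\<close>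

text \<open>With a symmetric set of generators, words without formal inverses reach all elements of the
generated subgroup.\<close>

definition symmetric_subset :: "('a, 'b) monoid_scheme \<Rightarrow> 'a set \<Rightarrow> bool" where
  "symmetric_subset G S \<longleftrightarrow> S \<subseteq> carrier G \<and> (\<forall>s\<in>S. inv\<^bsub>G\<^esub> s \<in> S)"

definition word_value :: "('a, 'b) monoid_scheme \<Rightarrow> 'a list \<Rightarrow> 'a" where
  "word_value G w = foldr (mult G) w \<one>\<^bsub>G\<^esub>"

lemma word_value_simps [simp]:
  "word_value G [] = \<one>\<^bsub>G\<^esub>" "word_value G (s # w) = s \<otimes>\<^bsub>G\<^esub> word_value G w"
  by (simp_all add: word_value_def)

lemma word_value_carrier_update [simp]: "word_value (G\<lparr>carrier := H\<rparr>) w = word_value G w"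
  by (simp add: word_value_def)

context group begin

lemma word_value_closed [simp]: "w \<in> lists (carrier G) \<Longrightarrow> word_value G w \<in> carrier G"
  by (induction w) auto

lemma word_value_append:
  "v \<in> lists (carrier G) \<Longrightarrow> w \<in> lists (carrier G) \<Longrightarrow>
    word_value G (v @ w) = word_value G v \<otimes> word_value G w"
  by (induction v) (auto simp: m_assoc)

lemma generate_eq_word_values:
  assumes "symmetric_subset G S"
  shows "generate G S = word_value G ` lists S"
proof
  have S: "S \<subseteq> carrier G" "\<And>s. s \<in> S \<Longrightarrow> inv s \<in> S"
    using assms by (auto simp: symmetric_subset_def)
  have L: "w \<in> lists (carrier G)" if "w \<in> lists S" for w
    using that lists_mono[OF S(1)] by auto
  show "generate G S \<subseteq> word_value G ` lists S"
  proof
    fix h assume "h \<in> generate G S"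
    then show "h \<in> word_value G ` lists S"
    proof (induction rule: generate.induct)
      case one
      show ?case by (intro image_eqI[of _ _ "[]"]) auto
    next
      case (incl h)
      then show ?case using S by (intro image_eqI[of _ _ "[h]"]) auto
    next
      case (inv h)
      then show ?case using S by (intro image_eqI[of _ _ "[inv h]"]) (auto simp: subset_iff)
    next
      case (eng h1 h2)
      then obtain v w where "v \<in> lists S" "w \<in> lists S" "h1 = word_value G v" "h2 = word_value G w"
        by auto
      then show ?case
        using word_value_append[OF L L, of v w] by (intro image_eqI[of _ _ "v @ w"]) auto
    qed
  qed
  have "word_value G w \<in> generate G S" if "w \<in> lists S" for w
    using that by (induction w) (auto intro: generate.one generate.eng generate.incl)
  then show "word_value G ` lists S \<subseteq> generate G S"
    by auto
qed

lemma symmetrize: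
  assumes "S \<subseteq> carrier G"
  shows "symmetric_subset G (S \<union> m_inv G ` S)" "generate G (S \<union> m_inv G ` S) = generate G S"
proof -
  show "symmetric_subset G (S \<union> m_inv G ` S)"
    using assms by (auto simp: symmetric_subset_def subset_iff)
  have "S \<union> m_inv G ` S \<subseteq> generate G S"
    by (auto intro: generate.incl generate.inv)
  then have "generate G (S \<union> m_inv G ` S) \<subseteq> generate G S"
    by (rule generate_subgroup_incl[OF _ generate_is_subgroup[OF assms]])
  moreover have "generate G S \<subseteq> generate G (S \<union> m_inv G ` S)"
    by (rule mono_generate) auto
  ultimately show "generate G (S \<union> m_inv G ` S) = generate G S" ..
qed

end

lemma locally_constant_word_value:
  assumes "w \<in> lists Pos"
  shows "locally_constant enumerated_group_space (\<lambda>c. word_value (coded_monoid c) w)"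
  using assms
proof (induction w)
  case Nil
  then show ?case by (simp add: locally_constant_one)
next
  case (Cons s w)
  have "word_value (coded_monoid c) w \<in> Pos" if "c \<in> enumerated_groups" for c
    using group.word_value_closed[OF group_coded_monoid[OF that]] Cons.hyps by simp
  then show ?case
    using Cons by (auto intro!: locally_constant_mult)
qed

lemma locally_constant_symmetric_subset:
  assumes "finite S"
  shows "locally_constant enumerated_group_space (\<lambda>c. symmetric_subset (coded_monoid c) S)"
proof (cases "S \<subseteq> Pos")
  case True
  then have "locally_constant enumerated_group_space (\<lambda>c. \<forall>s\<in>S. inv\<^bsub>coded_monoid c\<^esub> s \<in> S)"
    using assms by (intro locally_constant_Ball locally_constant_apply[where F = "\<lambda>t. t \<in> S"]
        locally_constant_inv) auto
  then show ?thesis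
    using True by (simp add: symmetric_subset_def)
qed (simp add: symmetric_subset_def)

section \<open>Local indicability\<close>

text \<open>A weight on the letters is invariant if it extends additively to the submonoid generated by
\<open>S\<close>, which is the generated subgroup if \<open>S\<close> is symmetric. In this form the domain,
and so the compact space of candidates, does not depend on the group.\<close>

definition word_invariant :: "('a, 'b) monoid_scheme \<Rightarrow> 'a set \<Rightarrow> ('a \<Rightarrow> 'c::comm_monoid_add) \<Rightarrow> bool"
  where "word_invariant G S \<phi> \<longleftrightarrow> (\<forall>v\<in>lists S. \<forall>w\<in>lists S.
     word_value G v = word_value G w \<longrightarrow> sum_list (map \<phi> v) = sum_list (map \<phi> w))"

lemma word_invariantD:
  assumes "word_invariant G S \<phi>" "v \<in> lists S" "w \<in> lists S" "word_value G v = word_value G w"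
  shows "sum_list (map \<phi> v) = sum_list (map \<phi> w)"
  using assms(1)[unfolded word_invariant_def, rule_format, OF assms(2-4)] .

lemma (in group) infinite_cyclic_quotient_imp_surj_hom:
  assumes "has_infinite_cyclic_quotient G"
  shows "\<exists>\<psi>\<in>hom G integer_group. \<psi> ` carrier G = UNIV"
proof -
  obtain N where N: "N \<lhd> G" "G Mod N \<cong> integer_group"
    using assms by (auto simp: has_infinite_cyclic_quotient_def)
  then obtain h where h: "h \<in> hom (G Mod N) integer_group"
    "h ` carrier (G Mod N) = UNIV"
    by (auto simp: is_iso_def iso_def bij_betw_def)
  have r: "(\<lambda>a. N #> a) \<in> hom G (G Mod N)"
    by (rule normal.r_coset_hom_Mod[OF N(1)])
  have "carrier (G Mod N) = (\<lambda>a. N #> a) ` carrier G"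
    by (auto simp: FactGroup_def RCOSETS_def)
  then have "(h \<circ> (\<lambda>a. N #> a)) ` carrier G = UNIV"
    using h(2) by (simp only: image_comp[symmetric])
  then show ?thesis
    by (rule bexI[OF _ Group.hom_compose[OF r h(1)]])
qed

text \<open>The image is a nonzero subgroup of the integers, hence consists of the multiples of its least
positive element \<open>d\<close>; dividing by \<open>d\<close> gives a surjection.\<close>

lemma (in group) nontrivial_hom_imp_infinite_cyclic_quotient:
  assumes \<psi>: "\<psi> \<in> hom G integer_group" and x0: "x0 \<in> carrier G" "\<psi> x0 \<noteq> 0"
  shows "has_infinite_cyclic_quotient G"
proof -
  interpret \<psi>: group_hom G integer_group \<psi>
    using \<psi> by (simp add: group_hom_def group_hom_axioms_def)
  have mult: "\<psi> (x \<otimes> y) = \<psi> x + \<psi> y" if "x \<in> carrier G" "y \<in> carrier G" for x y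
    using \<psi>.hom_mult[OF that] by simp
  have pow: "\<psi> (x [^] k) = k * \<psi> x" if "x \<in> carrier G" for x and k :: int
    using \<psi>.hom_int_pow[OF that, of k] by simp
  define d where "d = (LEAST n. n > 0 \<and> int n \<in> \<psi> ` carrier G)"
  have "\<exists>n. n > 0 \<and> int n \<in> \<psi> ` carrier G"
  proof (cases "\<psi> x0 > 0")
    case True
    then show ?thesis using x0 by (intro exI[of _ "nat (\<psi> x0)"]) auto
  next
    case False
    moreover have "- \<psi> x0 \<in> \<psi> ` carrier G"
      using x0 by (intro image_eqI[of _ _ "inv x0"]) auto
    ultimately show ?thesis using x0 by (intro exI[of _ "nat (- \<psi> x0)"]) auto
  qed
  then have d: "d > 0 \<and> int d \<in> \<psi> ` carrier G"
    unfolding d_def by (rule LeastI_ex)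
  have d_le: "d \<le> n" if "n > 0" "int n \<in> \<psi> ` carrier G" for n
    unfolding d_def using that by (intro Least_le conjI)
  obtain y where y: "y \<in> carrier G" "\<psi> y = int d" using d by auto
  have dvd: "int d dvd \<psi> x" if x: "x \<in> carrier G" for x
  proof -
    have eq: "\<psi> (x \<otimes> y [^] (- (\<psi> x div int d))) = \<psi> x mod int d"
      using x y by (simp add: mult pow minus_div_mult_eq_mod[symmetric])
    have "\<not> \<psi> x mod int d > 0"
    proof
      assume pos: "\<psi> x mod int d > 0"
      have "\<psi> x mod int d \<in> \<psi> ` carrier G"
        unfolding eq[symmetric] using x y by (intro imageI) simp
      then have "int (nat (\<psi> x mod int d)) \<in> \<psi> ` carrier G"
        using pos by simp
      then have "d \<le> nat (\<psi> x mod int d)"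
        using pos by (intro d_le) auto
      moreover have "\<psi> x mod int d < int d"
        using d by simp
      ultimately show False using pos by linarith
    qed
    moreover have "\<psi> x mod int d \<ge> 0" using d by simp
    ultimately show ?thesis by (simp add: dvd_eq_mod_eq_0)
  qed
  define \<theta> where "\<theta> x = \<psi> x div int d" for x
  have "\<theta> \<in> hom G integer_group"
    using dvd by (intro homI) (auto simp: \<theta>_def mult)
  then interpret \<theta>: group_hom G integer_group \<theta>
    by (simp add: group_hom_def group_hom_axioms_def)
  have "k \<in> \<theta> ` carrier G" for k
    using y d by (intro image_eqI[of _ _ "y [^] k"]) (auto simp: \<theta>_def pow)
  then have "\<theta> ` carrier G = carrier integer_group" by auto
  from \<theta>.FactGroup_iso[OF this] show ?thesis
    unfolding has_infinite_cyclic_quotient_def using \<theta>.normal_kernel by blast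
qed

text \<open>An element of the subgroup receives the total weight of any word that represents it; invariance
says that the choice of the word does not matter, and concatenation of words gives additivity.\<close>

lemma (in group) word_invariant_hom:
  assumes S: "symmetric_subset G S" and \<phi>: "word_invariant G S \<phi>"
  shows "\<exists>\<psi>\<in>hom (G\<lparr>carrier := generate G S\<rparr>) integer_group. \<forall>s\<in>S. \<psi> s = \<phi> s"
proof -
  have SG: "S \<subseteq> carrier G" using S by (simp add: symmetric_subset_def)
  have L: "w \<in> lists (carrier G)" if "w \<in> lists S" for w
    using that lists_mono[OF SG] by auto
  define \<psi> where "\<psi> h = sum_list (map \<phi> (SOME w. w \<in> lists S \<and> word_value G w = h))" for h
  have \<psi>: "\<psi> (word_value G w) = sum_list (map \<phi> w)" if "w \<in> lists S" for w
  proof -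
    let ?P = "\<lambda>v. v \<in> lists S \<and> word_value G v = word_value G w"
    have "?P (SOME v. ?P v)"
      by (rule someI[of ?P w]) (use that in auto)
    then show ?thesis
      unfolding \<psi>_def by (intro word_invariantD[OF \<phi> _ that]) auto
  qed
  have "\<psi> \<in> hom (G\<lparr>carrier := generate G S\<rparr>) integer_group"
  proof (rule homI)
    fix x y assume "x \<in> carrier (G\<lparr>carrier := generate G S\<rparr>)" "y \<in> carrier (G\<lparr>carrier := generate G S\<rparr>)"
    then obtain v w where vw: "v \<in> lists S" "w \<in> lists S" "x = word_value G v" "y = word_value G w"
      using generate_eq_word_values[OF S] by auto
    have "x \<otimes> y = word_value G (v @ w)"
      using vw word_value_append[OF L L] by simp
    moreover have "v @ w \<in> lists S" using vw by simp
    ultimately have "\<psi> (x \<otimes> y) = \<psi> x + \<psi> y"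
      using vw \<psi> by (simp del: append_in_lists_conv)
    then show "\<psi> (x \<otimes>\<^bsub>G\<lparr>carrier := generate G S\<rparr>\<^esub> y) = \<psi> x \<otimes>\<^bsub>integer_group\<^esub> \<psi> y"
      by simp
  qed simp
  moreover have "\<psi> s = \<phi> s" if "s \<in> S" for s
    using \<psi>[of "[s]"] that SG by auto
  ultimately show ?thesis by blast
qed

text \<open>The reals form a vector space over the rationals, and a nonzero \<open>x\<close> is part of a basis of
it, so some linear functional takes the value one at \<open>x\<close>.\<close>

lemma rational_functional:
  fixes x :: real
  assumes "x \<noteq> 0"
  obtains f :: "real \<Rightarrow> rat" where "\<And>a b. f (a + b) = f a + f b" "f x = 1"
proof -
  interpret Q: vector_space_pair "\<lambda>(q::rat) (x::real). of_rat q * x" "(*) :: rat \<Rightarrow> rat \<Rightarrow> rat"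
    by unfold_locales (auto simp: algebra_simps of_rat_add of_rat_mult)
  have "Q.vs1.independent {x}"
    using assms by simp
  from Q.linear_independent_extend[OF this, of "\<lambda>_. 1"]
  obtain f where f: "Vector_Spaces.linear (\<lambda>(q::rat) (x::real). of_rat q * x) (*) f" "f x = 1"
    by auto
  show ?thesis
    by (rule that[of f]) (use f Q.linear_add[OF f(1)] in auto)
qed

lemma common_denominator:
  fixes f :: "'a \<Rightarrow> rat"
  assumes "finite S"
  obtains D :: int where "D > 0" "\<And>s. s \<in> S \<Longrightarrow> of_int D * f s \<in> \<int>"
proof -
  define q where "q s = snd (quotient_of (f s))" for s
  have q: "q s > 0" "of_int (q s) * f s \<in> \<int>" for s
  proof -
    obtain a b where ab: "quotient_of (f s) = (a, b)" by fastforce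
    have "b > 0" "f s = of_int a / of_int b"
      using quotient_of_denom_pos[OF ab] quotient_of_div[OF ab] by auto
    moreover have "q s = b" by (simp add: q_def ab)
    ultimately show "q s > 0" "of_int (q s) * f s \<in> \<int>" by simp_all
  qed
  show ?thesis
  proof (rule that[of "\<Prod>s\<in>S. q s"])
    show "(\<Prod>s\<in>S. q s) > 0" using q by (simp add: prod_pos)
    fix s assume "s \<in> S"
    then have "of_int (\<Prod>s\<in>S. q s) * f s = of_int (\<Prod>t\<in>S - {s}. q t) * (of_int (q s) * f s)"
      using assms by (simp add: prod.remove)
    then show "of_int (\<Prod>s\<in>S. q s) * f s \<in> \<int>"
      using q(2) by (metis Ints_mult Ints_of_int)
  qed
qed

text \<open>A limit of integral weights, normalized to have maximum one, is only real. A rational linear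
functional that does not kill the value at \<open>s0\<close> turns it into a rational invariant weight, and
since there are finitely many letters a common denominator makes it integral.\<close>

lemma word_invariant_real_imp_int:
  fixes \<phi> :: "'a \<Rightarrow> real"
  assumes "finite S" and \<phi>: "word_invariant G S \<phi>" and s0: "s0 \<in> S" "\<phi> s0 \<noteq> 0"
  shows "\<exists>\<psi> :: 'a \<Rightarrow> int. word_invariant G S \<psi> \<and> \<psi> s0 \<noteq> 0"
proof -
  obtain f :: "real \<Rightarrow> rat" where f: "\<And>a b. f (a + b) = f a + f b" "f (\<phi> s0) = 1"
    using rational_functional[OF s0(2)] by metis
  obtain D :: int where D: "D > 0" "\<And>s. s \<in> S \<Longrightarrow> of_int D * f (\<phi> s) \<in> \<int>"
    using common_denominator[OF assms(1), of "\<lambda>s. f (\<phi> s)"] by metis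
  define \<psi> where "\<psi> s = \<lfloor>of_int D * f (\<phi> s)\<rfloor>" for s
  have \<psi>: "of_int (\<psi> s) = of_int D * f (\<phi> s)" if "s \<in> S" for s
    using D(2)[OF that] by (auto simp: \<psi>_def elim: Ints_cases)
  have f0: "f 0 = 0" using f(1)[of 0 0] by simp
  have sum: "of_int (sum_list (map \<psi> w)) = of_int D * f (sum_list (map \<phi> w))" if "w \<in> lists S" for w
    using that by (induction w) (auto simp: f f0 \<psi> algebra_simps)
  have "word_invariant G S \<psi>"
    unfolding word_invariant_def
  proof (intro ballI impI)
    fix v w assume vw: "v \<in> lists S" "w \<in> lists S" "word_value G v = word_value G w"
    then have "sum_list (map \<phi> v) = sum_list (map \<phi> w)"
      by (rule word_invariantD[OF \<phi>])
    then have "(of_int (sum_list (map \<psi> v)) :: rat) = of_int (sum_list (map \<psi> w))"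
      by (simp only: sum[OF vw(1)] sum[OF vw(2)])
    then show "sum_list (map \<psi> v) = sum_list (map \<psi> w)"
      by (simp only: of_int_eq_iff)
  qed
  moreover have "\<psi> s0 \<noteq> 0"
    using \<psi>[OF s0(1)] f(2) D(1) by auto
  ultimately show ?thesis by blast
qed

lemma (in group) hom_word_value:
  assumes "subgroup H G" "\<psi> \<in> hom (G\<lparr>carrier := H\<rparr>) integer_group" "w \<in> lists H"
  shows "\<psi> (word_value G w) = sum_list (map \<psi> w)"
proof -
  interpret \<psi>: group_hom "G\<lparr>carrier := H\<rparr>" integer_group \<psi>
    using assms subgroup_imp_group by (simp add: group_hom_def group_hom_axioms_def)
  show ?thesis
    using assms(3)
  proof (induction w)
    case Nil
    then show ?case using \<psi>.hom_one by simp
  next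
    case (Cons s w)
    then have "word_value G w \<in> H"
      using \<psi>.G.word_value_closed[of w] by simp
    then show ?case
      using Cons \<psi>.hom_mult[of s "word_value G w"] by simp
  qed
qed

lemma (in group) generate_trivial_iff:
  assumes "S \<subseteq> carrier G"
  shows "generate G S = {\<one>} \<longleftrightarrow> (\<forall>s\<in>S. s = \<one>)"
proof
  assume "generate G S = {\<one>}"
  then show "\<forall>s\<in>S. s = \<one>"
    using generate.incl[of _ S G] by auto
next
  assume "\<forall>s\<in>S. s = \<one>"
  then have "generate G S \<subseteq> generate G {\<one>}"
    by (intro mono_generate) auto
  then show "generate G S = {\<one>}"
    using generate_one generate.one[of G S] by auto
qed

text \<open>The normalization keeps the weight away from zero, so that limits of such weights are again
nontrivial.\<close>

definition normalized_character ::
  "('a, 'b) monoid_scheme \<Rightarrow> 'a set \<Rightarrow> ('a \<Rightarrow> real) \<Rightarrow> bool" where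
  "normalized_character G S \<phi> \<longleftrightarrow> (\<exists>s\<in>S. \<bar>\<phi> s\<bar> = 1) \<and> word_invariant G S \<phi>"

text \<open>A surjection onto the integers is nonzero on some generator, so it can be divided by the largest
absolute value that it takes on the generators.\<close>

lemma (in group) surj_hom_imp_normalized_character:
  assumes S: "finite S" "symmetric_subset G S"
    and \<psi>: "\<psi> \<in> hom (G\<lparr>carrier := generate G S\<rparr>) integer_group" "\<psi> ` generate G S = UNIV"
  shows "\<exists>\<phi>\<in>S \<rightarrow>\<^sub>E {-1..1}. normalized_character G S \<phi>"
proof -
  have SG: "S \<subseteq> carrier G" using S by (simp add: symmetric_subset_def)
  have "S \<subseteq> generate G S" by (auto intro: generate.incl)
  then have L: "w \<in> lists (generate G S)" if "w \<in> lists S" for w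
    using that lists_mono by auto
  have wv: "\<psi> (word_value G w) = sum_list (map \<psi> w)" if "w \<in> lists S" for w
    by (rule hom_word_value[OF generate_is_subgroup[OF SG] \<psi>(1) L[OF that]])
  have "\<exists>s\<in>S. \<psi> s \<noteq> 0"
  proof (rule ccontr)
    assume 0: "\<not> (\<exists>s\<in>S. \<psi> s \<noteq> 0)"
    have "sum_list (map \<psi> w) = 0" if "w \<in> lists S" for w
      using that 0 by (induction w) auto
    then have "\<psi> h = 0" if "h \<in> generate G S" for h
      using that wv unfolding generate_eq_word_values[OF S(2)] by auto
    moreover have "1 \<in> \<psi> ` generate G S"
      unfolding \<psi>(2) by simp
    ultimately show False by auto
  qed
  then obtain t where t: "t \<in> S" "\<psi> t \<noteq> 0" by blast
  define M where "M = Max ((\<lambda>s. \<bar>\<psi> s\<bar>) ` S)"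
  have "M \<in> (\<lambda>s. \<bar>\<psi> s\<bar>) ` S"
    unfolding M_def using S(1) t by (intro Max_in) auto
  then obtain s1 where s1: "s1 \<in> S" "\<bar>\<psi> s1\<bar> = M" by auto
  have le: "\<bar>\<psi> s\<bar> \<le> M" if "s \<in> S" for s
    unfolding M_def using S(1) that by (intro Max_ge) auto
  have M: "M > 0" using le[OF t(1)] t(2) by simp
  define \<phi> where "\<phi> = restrict (\<lambda>s. real_of_int (\<psi> s) / real_of_int M) S"
  have sum: "sum_list (map \<phi> w) = real_of_int (\<psi> (word_value G w)) / real_of_int M"
    if "w \<in> lists S" for w
  proof -
    have "sum_list (map \<phi> w) = real_of_int (sum_list (map \<psi> w)) / real_of_int M"
      using that by (induction w) (auto simp: \<phi>_def add_divide_distrib)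
    then show ?thesis using wv[OF that] by simp
  qed
  have "word_invariant G S \<phi>"
    by (simp add: word_invariant_def sum)
  moreover have "\<bar>\<phi> s1\<bar> = 1"
    using s1 M by (simp add: \<phi>_def)
  moreover have "\<phi> \<in> S \<rightarrow>\<^sub>E {-1..1}"
  proof -
    have "real_of_int (\<psi> s) / real_of_int M \<in> {-1..1}" if "s \<in> S" for s
    proof -
      have "real_of_int (- M) \<le> real_of_int (\<psi> s)" "real_of_int (\<psi> s) \<le> real_of_int M"
        using le[OF that] unfolding of_int_le_iff by auto
      then show ?thesis
        using M by (simp add: le_divide_eq divide_le_eq)
    qed
    then show ?thesis
      by (simp add: \<phi>_def)
  qed
  ultimately show ?thesis
    unfolding normalized_character_def using s1(1) by blast
qed

text \<open>For a finitely generated group, having an infinite cyclic quotient is expressed by a weight in the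
fixed compact cube \<open>[-1, 1]\<close> to the power \<open>S\<close>, subject to the normalization and to conditions
that involve two words each.\<close>

lemma (in group) locally_indicable_iff:
  "locally_indicable G \<longleftrightarrow> (\<forall>S. finite S \<and> symmetric_subset G S \<longrightarrow>
     (\<forall>s\<in>S. s = \<one>) \<or> (\<exists>\<phi>\<in>S \<rightarrow>\<^sub>E {-1..1}. normalized_character G S \<phi>))" (is "_ \<longleftrightarrow> ?R")
proof
  assume G: "locally_indicable G"
  show ?R
  proof (intro allI impI disj_imp[THEN iffD2])
    fix S assume S: "finite S \<and> symmetric_subset G S" and ne: "\<not> (\<forall>s\<in>S. s = \<one>)"
    let ?H = "generate G S"
    have SG: "S \<subseteq> carrier G" using S by (simp add: symmetric_subset_def)
    have H: "subgroup ?H G" by (rule generate_is_subgroup[OF SG])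
    have SH: "S \<subseteq> ?H" by (auto intro: generate.incl)
    have "finitely_generated (G\<lparr>carrier := ?H\<rparr>)"
      unfolding finitely_generated_def using S SH generate_consistent[OF SH H] by auto
    moreover have "?H \<noteq> {\<one>}"
      using ne generate_trivial_iff[OF SG] by simp
    ultimately have "has_infinite_cyclic_quotient (G\<lparr>carrier := ?H\<rparr>)"
      using G H unfolding locally_indicable_def by blast
    from group.infinite_cyclic_quotient_imp_surj_hom[OF subgroup_imp_group[OF H] this]
    obtain \<psi> where "\<psi> \<in> hom (G\<lparr>carrier := ?H\<rparr>) integer_group" "\<psi> ` ?H = UNIV"
      by auto
    then show "\<exists>\<phi>\<in>S \<rightarrow>\<^sub>E {-1..1}. normalized_character G S \<phi>"
      using surj_hom_imp_normalized_character S by blast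
  qed
next
  assume R: ?R
  show "locally_indicable G"
    unfolding locally_indicable_def
  proof (intro allI impI, elim conjE)
    fix H assume H: "subgroup H G" "H \<noteq> {\<one>}" "finitely_generated (G\<lparr>carrier := H\<rparr>)"
    then obtain S0 where S0: "finite S0" "S0 \<subseteq> H" "generate (G\<lparr>carrier := H\<rparr>) S0 = H"
      by (auto simp: finitely_generated_def)
    define S where "S = S0 \<union> m_inv G ` S0"
    have S0G: "S0 \<subseteq> carrier G"
      using S0(2) subgroup.subset[OF H(1)] by blast
    have S: "finite S" "symmetric_subset G S" "generate G S = H"
      using symmetrize[OF S0G] S0 generate_consistent[OF S0(2) H(1)] by (auto simp: S_def)
    have SG: "S \<subseteq> carrier G" using S by (simp add: symmetric_subset_def)
    have "\<not> (\<forall>s\<in>S. s = \<one>)"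
      using H(2) S(3) generate_trivial_iff[OF SG] by simp
    then obtain \<phi> where "normalized_character G S \<phi>"
      using R S by blast
    then obtain s where s: "s \<in> S" "\<bar>\<phi> s\<bar> = 1" "word_invariant G S \<phi>"
      by (auto simp: normalized_character_def)
    then have "\<phi> s \<noteq> 0" by auto
    then obtain \<psi> :: "'a \<Rightarrow> int" where \<psi>: "word_invariant G S \<psi>" "\<psi> s \<noteq> 0"
      using word_invariant_real_imp_int[OF S(1) s(3,1)] by blast
    obtain \<theta> where \<theta>: "\<theta> \<in> hom (G\<lparr>carrier := H\<rparr>) integer_group" "\<theta> s \<noteq> 0"
      using word_invariant_hom[OF S(2) \<psi>(1)] \<psi>(2) s(1) S(3) by auto
    have "s \<in> carrier (G\<lparr>carrier := H\<rparr>)"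
      using generate.incl[OF s(1), of G] S(3) by simp
    then show "has_infinite_cyclic_quotient (G\<lparr>carrier := H\<rparr>)"
      using group.nontrivial_hom_imp_infinite_cyclic_quotient[OF subgroup_imp_group[OF H(1)] \<theta>(1)] \<theta>(2)
      by blast
  qed
qed

lemma continuous_map_word_sum:
  assumes "w \<in> lists S"
  shows "continuous_map (prod_topology X (product_topology (\<lambda>_. top_of_set {-1..1}) S)) euclideanreal
    (\<lambda>z. sum_list (map (snd z) w))"
  using assms
proof (induction w)
  case (Cons s w)
  let ?K = "product_topology (\<lambda>_. top_of_set {-1..1::real}) S"
  have "continuous_map (prod_topology X ?K) (top_of_set {-1..1}) (\<lambda>z. snd z s)"
    by (rule continuous_map_compose[OF continuous_map_snd continuous_map_product_projection,
          unfolded o_def]) (use Cons in auto)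
  then have "continuous_map (prod_topology X ?K) euclideanreal (\<lambda>z. snd z s)"
    by (rule continuous_map_into_fulltopology)
  then show ?case
    using Cons by (auto intro: continuous_map_add)
qed simp

lemma closedin_continuous_eq:
  fixes f g :: "'a \<Rightarrow> real"
  assumes "continuous_map X euclideanreal f" "continuous_map X euclideanreal g"
  shows "closedin X {x \<in> topspace X. f x = g x}"
proof -
  have "continuous_map X euclideanreal (\<lambda>x. f x - g x)"
    using assms by (rule continuous_map_diff)
  from closedin_continuous_map_preimage[OF this, of "{0}"] show ?thesis
    by simp
qed

text \<open>For each pair of words the condition is closed jointly in the group and the weight: the premise
that the words have the same value is locally constant, and the conclusion is an equation between
continuous functions. The cube of weights is compact.\<close>

lemma closedin_normalized_character:
  assumes "finite S" "S \<subseteq> Pos"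
  shows "closedin enumerated_group_space {c \<in> topspace enumerated_group_space.
     \<exists>\<phi>\<in>topspace (product_topology (\<lambda>_. top_of_set {-1..1}) S). normalized_character (coded_monoid c) S \<phi>}"
proof (rule closedin_Collect_bex_compact)
  let ?K = "product_topology (\<lambda>_. top_of_set {-1..1::real}) S"
  let ?E = "enumerated_group_space"
  show "compact_space ?K"
    by (simp add: compact_space_product_topology compact_space_subtopology)
  have norm: "closedin (prod_topology ?E ?K) {z \<in> topspace (prod_topology ?E ?K). \<bar>snd z s\<bar> = 1}"
    if "s \<in> S" for s
    using continuous_map_word_sum[of "[s]" S ?E] that
    by (intro closedin_continuous_eq continuous_map_real_abs) auto
  have "{z \<in> topspace (prod_topology ?E ?K). \<exists>s\<in>S. \<bar>snd z s\<bar> = 1} =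
      (\<Union>s\<in>S. {z \<in> topspace (prod_topology ?E ?K). \<bar>snd z s\<bar> = 1})"
    by auto
  then have 1: "closedin (prod_topology ?E ?K)
      {z \<in> topspace (prod_topology ?E ?K). \<exists>s\<in>S. \<bar>snd z s\<bar> = 1}"
    using norm assms(1) by (auto intro!: closedin_Union)
  have lists: "w \<in> lists Pos" if "w \<in> lists S" for w
    using that lists_mono[OF assms(2)] by auto
  have 2: "closedin (prod_topology ?E ?K)
      {z \<in> topspace (prod_topology ?E ?K). word_invariant (coded_monoid (fst z)) S (snd z)}"
    unfolding word_invariant_def
  proof (intro closedin_Collect_ball closedin_Collect_locally_constant_imp closedin_continuous_eq
      continuous_map_word_sum)
    fix v w assume vw: "v \<in> lists S" "w \<in> lists S"
    have "locally_constant ?E (\<lambda>c. word_value (coded_monoid c) v = word_value (coded_monoid c) w)"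
      using vw lists by (intro locally_constant_apply2[where F = "(=)"] locally_constant_word_value) auto
    then show "locally_constant (prod_topology ?E ?K)
        (\<lambda>z. word_value (coded_monoid (fst z)) v = word_value (coded_monoid (fst z)) w)"
      by (rule locally_constant_compose[OF _ continuous_map_fst])
  qed
  show "closedin (prod_topology ?E ?K)
      {z \<in> topspace (prod_topology ?E ?K). normalized_character (coded_monoid (fst z)) S (snd z)}"
    unfolding normalized_character_def by (rule closedin_Collect_conj[OF 1 2])
qed

lemma closedin_locally_indicable:
  "closedin enumerated_group_space {c \<in> enumerated_groups. locally_indicable (coded_monoid c)}"
proof -
  let ?E = "enumerated_group_space"
  let ?P = "\<lambda>S c. \<exists>\<phi>\<in>topspace (product_topology (\<lambda>_. top_of_set {-1..1}) S).
      normalized_character (coded_monoid c) S \<phi>"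
  have "locally_indicable (coded_monoid c) \<longleftrightarrow> (\<forall>S. finite S \<and> S \<subseteq> Pos \<longrightarrow>
      \<not> symmetric_subset (coded_monoid c) S \<or> (\<forall>s\<in>S. s = \<one>\<^bsub>coded_monoid c\<^esub>) \<or> ?P S c)"
    if "c \<in> enumerated_groups" for c
    using group.locally_indicable_iff[OF group_coded_monoid[OF that]]
    by (auto simp: symmetric_subset_def)
  then have "{c \<in> enumerated_groups. locally_indicable (coded_monoid c)} =
    {c \<in> topspace ?E. \<forall>S. finite S \<and> S \<subseteq> Pos \<longrightarrow>
      \<not> symmetric_subset (coded_monoid c) S \<or> (\<forall>s\<in>S. s = \<one>\<^bsub>coded_monoid c\<^esub>) \<or> ?P S c}"
    unfolding topspace_enumerated_group_space by (intro Collect_cong conj_cong refl)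
  moreover have "closedin ?E \<dots>"
  proof (intro closedin_Collect_all closedin_Collect_imp)
    fix S :: "nat set" assume S: "finite S \<and> S \<subseteq> Pos"
    then show "closedin ?E {c \<in> topspace ?E.
        \<not> symmetric_subset (coded_monoid c) S \<or> (\<forall>s\<in>S. s = \<one>\<^bsub>coded_monoid c\<^esub>) \<or> ?P S c}"
      by (intro closedin_Collect_disj closedin_normalized_character closedin_locally_constant
          locally_constant_apply[where F = Not] locally_constant_symmetric_subset locally_constant_Ball
          locally_constant_apply2[where F = "(=)"] locally_constant_const locally_constant_one) auto
  qed
  ultimately show ?thesis by simp
qed

section \<open>Homomorphisms between balls of labelled digraphs\<close>

definition wf_digraph :: "('v, 'l) labeled_digraph \<Rightarrow> bool" where
  "wf_digraph \<Gamma> \<longleftrightarrow> edges \<Gamma> \<subseteq> vertices \<Gamma> \<times> UNIV \<times> vertices \<Gamma>"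

lemma wf_digraphD:
  assumes "wf_digraph \<Gamma>" "(u, s, v) \<in> edges \<Gamma>"
  shows "u \<in> vertices \<Gamma>" "v \<in> vertices \<Gamma>"
  using assms by (auto simp: wf_digraph_def)

lemma finite_labeled_digraph_imp_wf: "finite_labeled_digraph S \<Gamma> \<Longrightarrow> wf_digraph \<Gamma>"
  by (auto simp: finite_labeled_digraph_def wf_digraph_def)

lemma graph_ball_subset: "graph_ball \<Gamma> n p \<subseteq> vertices \<Gamma>"
  by (auto simp: graph_ball_def)

lemma graph_ball_mono: "v \<in> graph_ball \<Gamma> m p \<Longrightarrow> m \<le> n \<Longrightarrow> v \<in> graph_ball \<Gamma> n p"
  by (auto simp: graph_ball_def intro: order_trans)

lemma graph_ball_0: "graph_ball \<Gamma> 0 p = vertices \<Gamma> \<inter> {p}"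
  by (auto simp: graph_ball_def)

lemma graph_ball_root: "p \<in> vertices \<Gamma> \<Longrightarrow> p \<in> graph_ball \<Gamma> n p"
  using graph_ball_mono[of p \<Gamma> 0 p n] by (simp add: graph_ball_0)

lemma graph_ball_Suc:
  assumes "wf_digraph \<Gamma>"
  shows "graph_ball \<Gamma> (Suc n) p =
    graph_ball \<Gamma> n p \<union> {v. \<exists>u\<in>graph_ball \<Gamma> n p. (u, v) \<in> adjacency \<Gamma>}" (is "?L = ?R")
proof
  have V: "u \<in> vertices \<Gamma>" "v \<in> vertices \<Gamma>" if "(u, v) \<in> adjacency \<Gamma>" for u v
    using that wf_digraphD[OF assms] by (auto simp: adjacency_def)
  show "?L \<subseteq> ?R"
  proof
    fix v assume "v \<in> ?L"
    then obtain k where k: "k \<le> Suc n" "(p, v) \<in> adjacency \<Gamma> ^^ k" "v \<in> vertices \<Gamma>"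
      by (auto simp: graph_ball_def)
    show "v \<in> ?R"
    proof (cases "k \<le> n")
      case True
      then show ?thesis using k by (auto simp: graph_ball_def)
    next
      case False
      then have "k = Suc n" using k(1) by simp
      then obtain u where u: "(p, u) \<in> adjacency \<Gamma> ^^ n" "(u, v) \<in> adjacency \<Gamma>"
        using k(2) by auto
      then have "u \<in> graph_ball \<Gamma> n p"
        using V(1) by (auto simp: graph_ball_def)
      then show ?thesis using u(2) by auto
    qed
  qed
  show "?R \<subseteq> ?L"
  proof
    fix v assume "v \<in> ?R"
    then consider "v \<in> graph_ball \<Gamma> n p" | u where "u \<in> graph_ball \<Gamma> n p" "(u, v) \<in> adjacency \<Gamma>"
      by auto
    then show "v \<in> ?L"
    proof cases
      case 1
      then show ?thesis by (rule graph_ball_mono) simp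
    next
      case 2
      then obtain k where "k \<le> n" "(p, u) \<in> adjacency \<Gamma> ^^ k"
        by (auto simp: graph_ball_def)
      then have "Suc k \<le> Suc n" "(p, v) \<in> adjacency \<Gamma> ^^ Suc k"
        using 2 by auto
      then show ?thesis
        using V(2)[OF 2(2)] unfolding graph_ball_def by blast
    qed
  qed
qed

lemma graph_ball_step:
  assumes "wf_digraph \<Gamma>" "u \<in> graph_ball \<Gamma> n p" "(u, s, v) \<in> edges \<Gamma> \<or> (v, s, u) \<in> edges \<Gamma>"
  shows "v \<in> graph_ball \<Gamma> (Suc n) p"
proof -
  have "(u, v) \<in> adjacency \<Gamma>" using assms(3) by (auto simp: adjacency_def)
  then show ?thesis using assms(2) unfolding graph_ball_Suc[OF assms(1)] by auto
qed

text \<open>One half of a rooted isomorphism of balls. An isomorphism is split into two such maps, inverse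
to each other on the balls, so that statements about it need only be proved for maps in one
direction.\<close>

definition ball_hom ::
  "('v, 'l) labeled_digraph \<Rightarrow> 'v \<Rightarrow> ('w, 'l) labeled_digraph \<Rightarrow> 'w \<Rightarrow> nat \<Rightarrow> ('v \<Rightarrow> 'w) \<Rightarrow> bool"
  where
  "ball_hom \<Gamma> p \<Delta> q n f \<longleftrightarrow> f p = q \<and>
     (\<forall>u\<in>graph_ball \<Gamma> n p. f u \<in> graph_ball \<Delta> n q) \<and>
     (\<forall>u\<in>graph_ball \<Gamma> n p. \<forall>v\<in>graph_ball \<Gamma> n p. \<forall>s.
        (u, s, v) \<in> edges \<Gamma> \<longrightarrow> (f u, s, f v) \<in> edges \<Delta>)"

definition balls_isomorphic ::
  "('v, 'l) labeled_digraph \<Rightarrow> 'v \<Rightarrow> ('w, 'l) labeled_digraph \<Rightarrow> 'w \<Rightarrow> nat \<Rightarrow> bool" where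
  "balls_isomorphic \<Gamma> p \<Delta> q n \<longleftrightarrow> (\<exists>f g. ball_hom \<Gamma> p \<Delta> q n f \<and> ball_hom \<Delta> q \<Gamma> p n g \<and>
     (\<forall>u\<in>graph_ball \<Gamma> n p. g (f u) = u) \<and> (\<forall>v\<in>graph_ball \<Delta> n q. f (g v) = v))"

lemma ball_homD:
  assumes "ball_hom \<Gamma> p \<Delta> q n f"
  shows "f p = q"
    and "u \<in> graph_ball \<Gamma> n p \<Longrightarrow> f u \<in> graph_ball \<Delta> n q"
    and "u \<in> graph_ball \<Gamma> n p \<Longrightarrow> v \<in> graph_ball \<Gamma> n p \<Longrightarrow> (u, s, v) \<in> edges \<Gamma> \<Longrightarrow>
      (f u, s, f v) \<in> edges \<Delta>"
  using assms by (simp_all add: ball_hom_def)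

lemma rooted_isomorphic_iff:
  assumes "p \<in> vertices \<Gamma>"
  shows "rooted_isomorphic (neighborhood \<Gamma> n p) p (neighborhood \<Delta> n q) q \<longleftrightarrow>
    balls_isomorphic \<Gamma> p \<Delta> q n"
proof
  let ?A = "graph_ball \<Gamma> n p" and ?B = "graph_ball \<Delta> n q"
  assume "rooted_isomorphic (neighborhood \<Gamma> n p) p (neighborhood \<Delta> n q) q"
  then obtain f where f: "bij_betw f ?A ?B" "f p = q"
    and edge: "\<And>u v s. u \<in> ?A \<Longrightarrow> v \<in> ?A \<Longrightarrow>
      (u, s, v) \<in> edges (neighborhood \<Gamma> n p) \<longleftrightarrow> (f u, s, f v) \<in> edges (neighborhood \<Delta> n q)"
    unfolding rooted_isomorphic_def by (auto simp: neighborhood_def)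
  have fA: "f u \<in> ?B" if "u \<in> ?A" for u
    using f(1) that by (rule bij_betwE[rule_format])
  have edge: "(u, s, v) \<in> edges \<Gamma> \<longleftrightarrow> (f u, s, f v) \<in> edges \<Delta>" if "u \<in> ?A" "v \<in> ?A" for u v s
    using edge[OF that, of s] that fA by (simp add: neighborhood_def)
  define g where "g = inv_into ?A f"
  have gB: "g v \<in> ?A" if "v \<in> ?B" for v
    using f(1) that bij_betw_inv_into[OF f(1)] unfolding g_def by (auto simp: bij_betw_def)
  have gf: "g (f u) = u" if "u \<in> ?A" for u
    unfolding g_def by (rule bij_betw_inv_into_left[OF f(1) that])
  have fg: "f (g v) = v" if "v \<in> ?B" for v
    unfolding g_def by (rule bij_betw_inv_into_right[OF f(1) that])
  have "ball_hom \<Gamma> p \<Delta> q n f"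
    using f(2) fA edge by (simp add: ball_hom_def)
  moreover have "ball_hom \<Delta> q \<Gamma> p n g"
    using gf[OF graph_ball_root[OF assms]] f(2) gB edge[OF gB gB] fg by (simp add: ball_hom_def)
  ultimately show "balls_isomorphic \<Gamma> p \<Delta> q n"
    unfolding balls_isomorphic_def using gf fg by blast
next
  let ?A = "graph_ball \<Gamma> n p" and ?B = "graph_ball \<Delta> n q"
  assume "balls_isomorphic \<Gamma> p \<Delta> q n"
  then obtain f g where f: "ball_hom \<Gamma> p \<Delta> q n f" and g: "ball_hom \<Delta> q \<Gamma> p n g"
    and gf: "\<And>u. u \<in> ?A \<Longrightarrow> g (f u) = u" and fg: "\<And>v. v \<in> ?B \<Longrightarrow> f (g v) = v"
    unfolding balls_isomorphic_def by blast
  have "bij_betw f ?A ?B"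
    using ball_homD(2)[OF f] ball_homD(2)[OF g] gf fg by (intro bij_betw_byWitness[of _ g]) auto
  moreover have "(u, s, v) \<in> edges \<Gamma> \<longleftrightarrow> (f u, s, f v) \<in> edges \<Delta>" if "u \<in> ?A" "v \<in> ?A" for u s v
    using ball_homD(3)[OF f that, of s] ball_homD(3)[OF g ball_homD(2)[OF f that(1)] ball_homD(2)[OF f that(2)], of s]
      gf that by auto
  ultimately show "rooted_isomorphic (neighborhood \<Gamma> n p) p (neighborhood \<Delta> n q) q"
    unfolding rooted_isomorphic_def using ball_homD(1,2)[OF f]
    by (intro exI[of _ f]) (simp add: neighborhood_def)
qed

lemma ball_hom_comp:
  assumes "ball_hom \<Gamma> p \<Delta> q n f" "ball_hom \<Delta> q \<Lambda> r n g"
  shows "ball_hom \<Gamma> p \<Lambda> r n (g \<circ> f)"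
  using ball_homD[OF assms(1)] ball_homD[OF assms(2)] by (simp add: ball_hom_def)

lemma balls_isomorphic_trans:
  assumes "balls_isomorphic \<Gamma> p \<Delta> q n" "balls_isomorphic \<Delta> q \<Lambda> r n"
  shows "balls_isomorphic \<Gamma> p \<Lambda> r n"
proof -
  obtain f g where f: "ball_hom \<Gamma> p \<Delta> q n f" and g: "ball_hom \<Delta> q \<Gamma> p n g"
    and gf: "\<And>u. u \<in> graph_ball \<Gamma> n p \<Longrightarrow> g (f u) = u"
    and fg: "\<And>v. v \<in> graph_ball \<Delta> n q \<Longrightarrow> f (g v) = v"
    using assms(1) unfolding balls_isomorphic_def by blast
  obtain f' g' where f': "ball_hom \<Delta> q \<Lambda> r n f'" and g': "ball_hom \<Lambda> r \<Delta> q n g'"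
    and gf': "\<And>u. u \<in> graph_ball \<Delta> n q \<Longrightarrow> g' (f' u) = u"
    and fg': "\<And>v. v \<in> graph_ball \<Lambda> n r \<Longrightarrow> f' (g' v) = v"
    using assms(2) unfolding balls_isomorphic_def by blast
  have "\<forall>u\<in>graph_ball \<Gamma> n p. (g \<circ> g') ((f' \<circ> f) u) = u"
    using gf gf' ball_homD(2)[OF f] by simp
  moreover have "\<forall>v\<in>graph_ball \<Lambda> n r. (f' \<circ> f) ((g \<circ> g') v) = v"
    using fg fg' ball_homD(2)[OF g'] by simp
  ultimately show ?thesis
    unfolding balls_isomorphic_def using ball_hom_comp[OF f f'] ball_hom_comp[OF g' g] by blast
qed

lemma ball_hom_of_digraph_hom:
  assumes V: "\<And>u. u \<in> vertices \<Gamma> \<Longrightarrow> f u \<in> vertices \<Delta>"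
    and E: "\<And>u s v. (u, s, v) \<in> edges \<Gamma> \<Longrightarrow> (f u, s, f v) \<in> edges \<Delta>"
  shows "ball_hom \<Gamma> p \<Delta> (f p) n f"
proof -
  have "(f p, f u) \<in> adjacency \<Delta> ^^ k" if "(p, u) \<in> adjacency \<Gamma> ^^ k" for u k
    using that
  proof (induction k arbitrary: u)
    case (Suc k)
    then obtain x where x: "(p, x) \<in> adjacency \<Gamma> ^^ k" "(x, u) \<in> adjacency \<Gamma>" by auto
    have "(f x, f u) \<in> adjacency \<Delta>"
      using x(2) E unfolding adjacency_def by blast
    then show ?case using Suc.IH[OF x(1)] by auto
  qed simp
  then have "f u \<in> graph_ball \<Delta> n (f p)" if "u \<in> graph_ball \<Gamma> n p" for u
    using that V unfolding graph_ball_def by blast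
  then show ?thesis using E by (simp add: ball_hom_def)
qed

section \<open>Substitution of words for labels\<close>

primrec walk :: "('v, 'l) labeled_digraph \<Rightarrow> 'l list \<Rightarrow> 'v \<Rightarrow> 'v \<Rightarrow> bool" where
  "walk \<Gamma> [] u v \<longleftrightarrow> u = v"
| "walk \<Gamma> (s # w) u v \<longleftrightarrow> (\<exists>x. (u, s, x) \<in> edges \<Gamma> \<and> walk \<Gamma> w x v)"

text \<open>The digraph in which an edge with label \<open>t\<close> stands for a walk along the word \<open>W t\<close>.
For a Cayley graph this is the change of the generating set. The walks that start or end near a
good vertex of a finite approximation stay in the part of the graph that looks like the Cayley
graph, so the construction turns approximations for one generating set into approximations for
another one.\<close>

definition substitute ::
  "('t \<Rightarrow> 'l list) \<Rightarrow> 't set \<Rightarrow> ('v, 'l) labeled_digraph \<Rightarrow> ('v, 't) labeled_digraph" where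
  "substitute W T \<Gamma> = \<lparr>vertices = vertices \<Gamma>,
     edges = {(u, t, v). u \<in> vertices \<Gamma> \<and> t \<in> T \<and> walk \<Gamma> (W t) u v}\<rparr>"

lemma vertices_substitute [simp]: "vertices (substitute W T \<Gamma>) = vertices \<Gamma>"
  by (simp add: substitute_def)

lemma edges_substitute_iff:
  "(u, t, v) \<in> edges (substitute W T \<Gamma>) \<longleftrightarrow> u \<in> vertices \<Gamma> \<and> t \<in> T \<and> walk \<Gamma> (W t) u v"
  by (simp add: substitute_def)

lemma walk_in_vertices:
  "wf_digraph \<Gamma> \<Longrightarrow> walk \<Gamma> w u v \<Longrightarrow> u \<in> vertices \<Gamma> \<Longrightarrow> v \<in> vertices \<Gamma>"
  by (induction w arbitrary: u) (auto dest: wf_digraphD)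

lemma edges_substitute_subset:
  assumes "wf_digraph \<Gamma>"
  shows "edges (substitute W T \<Gamma>) \<subseteq> vertices \<Gamma> \<times> T \<times> vertices \<Gamma>"
  using walk_in_vertices[OF assms] by (auto simp: substitute_def)

lemma wf_substitute: "wf_digraph \<Gamma> \<Longrightarrow> wf_digraph (substitute W T \<Gamma>)"
  using edges_substitute_subset[of \<Gamma> W T] by (auto simp: wf_digraph_def)

lemma walk_graph_ball:
  assumes "wf_digraph \<Gamma>" "walk \<Gamma> w u v"
  shows "u \<in> graph_ball \<Gamma> k p \<Longrightarrow> v \<in> graph_ball \<Gamma> (k + length w) p"
    and "v \<in> graph_ball \<Gamma> k p \<Longrightarrow> u \<in> graph_ball \<Gamma> (k + length w) p"
proof -
  show "v \<in> graph_ball \<Gamma> (k + length w) p" if "u \<in> graph_ball \<Gamma> k p"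
    using assms(2) that
  proof (induction w arbitrary: u k)
    case (Cons s w)
    then obtain x where x: "(u, s, x) \<in> edges \<Gamma>" "walk \<Gamma> w x v" by auto
    from Cons.IH[OF x(2) graph_ball_step[OF assms(1) Cons.prems(2)]] x(1)
    show ?case by auto
  qed simp
  show "u \<in> graph_ball \<Gamma> (k + length w) p" if "v \<in> graph_ball \<Gamma> k p"
    using assms(2) that
  proof (induction w arbitrary: u)
    case (Cons s w)
    then obtain x where x: "(u, s, x) \<in> edges \<Gamma>" "walk \<Gamma> w x v" by auto
    from graph_ball_step[OF assms(1) Cons.IH[OF x(2) Cons.prems(2)]] x(1)
    show ?case by auto
  qed simp
qed

lemma ball_hom_walk:
  assumes "wf_digraph \<Gamma>" "ball_hom \<Gamma> p \<Delta> q N f"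
  shows "walk \<Gamma> w u v \<Longrightarrow> u \<in> graph_ball \<Gamma> k p \<Longrightarrow> k + length w \<le> N \<Longrightarrow> walk \<Delta> w (f u) (f v)"
proof (induction w arbitrary: u k)
  case (Cons s w)
  then obtain x where x: "(u, s, x) \<in> edges \<Gamma>" "walk \<Gamma> w x v" by auto
  have x': "x \<in> graph_ball \<Gamma> (Suc k) p"
    using graph_ball_step[OF assms(1) Cons.prems(2)] x(1) by blast
  have "u \<in> graph_ball \<Gamma> N p" "x \<in> graph_ball \<Gamma> N p"
    using graph_ball_mono[OF Cons.prems(2)] graph_ball_mono[OF x'] Cons.prems(3) by simp_all
  then have "(f u, s, f x) \<in> edges \<Delta>"
    using ball_homD(3)[OF assms(2)] x(1) by blast
  moreover have "walk \<Delta> w (f x) (f v)"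
    using Cons.IH[OF x(2) x'] Cons.prems(3) by simp
  ultimately show ?case by auto
qed simp

lemma graph_ball_substitute:
  assumes wf: "wf_digraph \<Gamma>" and L: "\<And>t. t \<in> T \<Longrightarrow> length (W t) \<le> L"
  shows "graph_ball (substitute W T \<Gamma>) k p \<subseteq> graph_ball \<Gamma> (k * L) p"
proof (induction k)
  case 0
  then show ?case by (simp add: graph_ball_0)
next
  case (Suc k)
  have le: "k * L \<le> Suc k * L" by simp
  show ?case
  proof
    fix v assume "v \<in> graph_ball (substitute W T \<Gamma>) (Suc k) p"
    then consider "v \<in> graph_ball (substitute W T \<Gamma>) k p" |
      u where "u \<in> graph_ball (substitute W T \<Gamma>) k p" "(u, v) \<in> adjacency (substitute W T \<Gamma>)"
      unfolding graph_ball_Suc[OF wf_substitute[OF wf]] by auto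
    then show "v \<in> graph_ball \<Gamma> (Suc k * L) p"
    proof cases
      case 1
      show ?thesis by (rule graph_ball_mono[OF subsetD[OF Suc.IH 1] le])
    next
      case 2
      then have u: "u \<in> graph_ball \<Gamma> (k * L) p" using Suc.IH by blast
      obtain t where t: "t \<in> T" "walk \<Gamma> (W t) u v \<or> walk \<Gamma> (W t) v u"
        using 2(2) by (auto simp: adjacency_def edges_substitute_iff)
      have "v \<in> graph_ball \<Gamma> (k * L + length (W t)) p"
        using t(2) walk_graph_ball[OF wf, of "W t"] u by blast
      moreover have "k * L + length (W t) \<le> Suc k * L"
        using L[OF t(1)] by simp
      ultimately show ?thesis by (rule graph_ball_mono)
    qed
  qed
qed

text \<open>The condition on \<open>N\<close> has one \<open>L\<close> for each of the \<open>n\<close> steps, one because an edge may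
start outside the ball and end inside it, which puts its start up to \<open>L\<close> further away, and
one for following the walk from there.\<close>

lemma ball_hom_substitute:
  assumes wf: "wf_digraph \<Gamma>" "wf_digraph \<Delta>" and p: "p \<in> vertices \<Gamma>"
    and L: "\<And>t. t \<in> T \<Longrightarrow> length (W t) \<le> L"
    and f: "ball_hom \<Gamma> p \<Delta> q N f" and N: "(n + 2) * L \<le> N"
  shows "ball_hom (substitute W T \<Gamma>) p (substitute W T \<Delta>) q n f"
proof -
  let ?\<Gamma> = "substitute W T \<Gamma>" and ?\<Delta> = "substitute W T \<Delta>"
  have sub: "graph_ball ?\<Gamma> k p \<subseteq> graph_ball \<Gamma> (k * L) p" for k
    by (rule graph_ball_substitute[OF wf(1) L])
  have edge: "(f u, t, f v) \<in> edges ?\<Delta>"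
    if uv: "u \<in> graph_ball ?\<Gamma> k p \<or> v \<in> graph_ball ?\<Gamma> k p" and k: "k \<le> n" and e: "(u, t, v) \<in> edges ?\<Gamma>"
    for u t v k
  proof -
    have e': "u \<in> vertices \<Gamma>" "t \<in> T" "walk \<Gamma> (W t) u v"
      using e by (auto simp: edges_substitute_iff)
    have "Suc k * L + L \<le> (n + 2) * L"
      using k by (metis add_mult_distrib mult_le_mono1 add_2_eq_Suc' add.commute mult_Suc Suc_le_mono)
    then have kN: "Suc k * L + length (W t) \<le> N"
      using L[OF e'(2)] N by linarith
    have "u \<in> graph_ball \<Gamma> (k * L) p \<or> v \<in> graph_ball \<Gamma> (k * L) p"
      using uv sub[of k] by blast
    then have "u \<in> graph_ball \<Gamma> (k * L + length (W t)) p"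
    proof
      assume "u \<in> graph_ball \<Gamma> (k * L) p"
      then show ?thesis by (rule graph_ball_mono) simp
    qed (rule walk_graph_ball(2)[OF wf(1) e'(3)])
    then have u: "u \<in> graph_ball \<Gamma> (Suc k * L) p"
      by (rule graph_ball_mono) (use L[OF e'(2)] in simp)
    then have "u \<in> graph_ball \<Gamma> N p"
      by (rule graph_ball_mono) (use kN in simp)
    then have "f u \<in> vertices \<Delta>"
      by (rule subsetD[OF graph_ball_subset, OF ball_homD(2)[OF f]])
    then show ?thesis
      using ball_hom_walk[OF wf(1) f e'(3) u kN] e'(2) by (simp add: edges_substitute_iff)
  qed
  have ball: "f v \<in> graph_ball ?\<Delta> k q" if "v \<in> graph_ball ?\<Gamma> k p" "k \<le> n" for v k
    using that
  proof (induction k arbitrary: v)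
    case 0
    then have "v = p" by (simp add: graph_ball_0)
    moreover have "q \<in> vertices \<Delta>"
      using subsetD[OF graph_ball_subset, OF ball_homD(2)[OF f graph_ball_root[OF p]]]
        ball_homD(1)[OF f] by simp
    ultimately show ?case using ball_homD(1)[OF f] by (simp add: graph_ball_0)
  next
    case (Suc k)
    then consider "v \<in> graph_ball ?\<Gamma> k p" |
      u where "u \<in> graph_ball ?\<Gamma> k p" "(u, v) \<in> adjacency ?\<Gamma>"
      unfolding graph_ball_Suc[OF wf_substitute[OF wf(1)]] by auto
    then show ?case
    proof cases
      case 1
      then show ?thesis
        using Suc.IH[of v] Suc.prems(2) graph_ball_mono[of "f v" ?\<Delta> k q "Suc k"] by simp
    next
      case 2
      have k: "k \<le> n" using Suc.prems(2) by simp
      obtain t where "(u, t, v) \<in> edges ?\<Gamma> \<or> (v, t, u) \<in> edges ?\<Gamma>"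
        using 2(2) by (auto simp: adjacency_def)
      then have "(f u, t, f v) \<in> edges ?\<Delta> \<or> (f v, t, f u) \<in> edges ?\<Delta>"
        using edge[OF _ k] 2(1) by blast
      then show ?thesis
        by (rule graph_ball_step[OF wf_substitute[OF wf(2)] Suc.IH[OF 2(1) k]])
    qed
  qed
  show ?thesis
    unfolding ball_hom_def
  proof (intro conjI ballI allI impI)
    show "f p = q" by (rule ball_homD(1)[OF f])
    show "f u \<in> graph_ball ?\<Delta> n q" if "u \<in> graph_ball ?\<Gamma> n p" for u
      by (rule ball[OF that order_refl])
    show "(f u, t, f v) \<in> edges ?\<Delta>"
      if "u \<in> graph_ball ?\<Gamma> n p" "(u, t, v) \<in> edges ?\<Gamma>" for u t v
      by (rule edge[OF disjI1[OF that(1)] order_refl that(2)])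
  qed
qed

lemma balls_isomorphic_substitute:
  assumes wf: "wf_digraph \<Gamma>" "wf_digraph \<Delta>" and pq: "p \<in> vertices \<Gamma>" "q \<in> vertices \<Delta>"
    and L: "\<And>t. t \<in> T \<Longrightarrow> length (W t) \<le> L"
    and iso: "balls_isomorphic \<Gamma> p \<Delta> q N" and N: "(n + 2) * L \<le> N"
  shows "balls_isomorphic (substitute W T \<Gamma>) p (substitute W T \<Delta>) q n"
proof -
  obtain f g where f: "ball_hom \<Gamma> p \<Delta> q N f" and g: "ball_hom \<Delta> q \<Gamma> p N g"
    and gf: "\<And>u. u \<in> graph_ball \<Gamma> N p \<Longrightarrow> g (f u) = u"
    and fg: "\<And>v. v \<in> graph_ball \<Delta> N q \<Longrightarrow> f (g v) = v"
    using iso unfolding balls_isomorphic_def by blast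
  have "n * L \<le> N" using N by simp
  then have mono: "graph_ball \<Gamma> (n * L) p \<subseteq> graph_ball \<Gamma> N p" "graph_ball \<Delta> (n * L) q \<subseteq> graph_ball \<Delta> N q"
    by (auto intro: graph_ball_mono)
  have "graph_ball (substitute W T \<Gamma>) n p \<subseteq> graph_ball \<Gamma> N p"
    by (rule order_trans[OF graph_ball_substitute[OF wf(1) L] mono(1)])
  moreover have "graph_ball (substitute W T \<Delta>) n q \<subseteq> graph_ball \<Delta> N q"
    by (rule order_trans[OF graph_ball_substitute[OF wf(2) L] mono(2)])
  ultimately show ?thesis
    unfolding balls_isomorphic_def
    using ball_hom_substitute[OF wf pq(1) L f N] ball_hom_substitute[OF wf(2,1) pq(2) L g N] gf fg
    by (intro exI[of _ f] exI[of _ g]) auto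
qed

section \<open>Soficity\<close>

lemma vertices_cayley_graph [simp]: "vertices (cayley_graph G S) = carrier G"
  by (simp add: cayley_graph_def)

lemma edges_cayley_graph_iff:
  "(g, s, h) \<in> edges (cayley_graph G S) \<longleftrightarrow> g \<in> carrier G \<and> s \<in> S \<and> h = g \<otimes>\<^bsub>G\<^esub> s"
  by (simp add: cayley_graph_def)

context group begin

lemma wf_cayley_graph: "S \<subseteq> carrier G \<Longrightarrow> wf_digraph (cayley_graph G S)"
  by (auto simp: wf_digraph_def cayley_graph_def)

lemma walk_cayley_graph:
  assumes "S \<subseteq> carrier G" "w \<in> lists S" "g \<in> carrier G"
  shows "walk (cayley_graph G S) w g h \<longleftrightarrow> h = g \<otimes> word_value G w"
  using assms(2,3)
proof (induction w arbitrary: g)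
  case (Cons s w)
  have s: "s \<in> carrier G" using Cons.hyps assms(1) by auto
  have "w \<in> lists (carrier G)" using Cons.hyps lists_mono[OF assms(1)] by auto
  then show ?case
    using Cons s by (simp add: edges_cayley_graph_iff m_assoc)
qed auto

lemma substitute_cayley_graph:
  assumes "S \<subseteq> carrier G" "\<And>t. t \<in> T \<Longrightarrow> W t \<in> lists S \<and> word_value G (W t) = t"
  shows "substitute W T (cayley_graph G S) = cayley_graph G T"
proof -
  have "(u, t, v) \<in> edges (substitute W T (cayley_graph G S)) \<longleftrightarrow> (u, t, v) \<in> edges (cayley_graph G T)"
    for u t v
    using walk_cayley_graph[OF assms(1), of "W t" u v] assms(2)[of t]
    by (auto simp: edges_substitute_iff edges_cayley_graph_iff)
  then have "edges (substitute W T (cayley_graph G S)) = edges (cayley_graph G T)"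
    by (metis (no_types, lifting) prod_cases3 subsetI subset_antisym)
  then show ?thesis
    by (simp add: substitute_def cayley_graph_def)
qed

text \<open>The same vertices are good in both graphs, and the demand on their proportion is weaker for
\<open>n\<close> than for \<open>N\<close>.\<close>

lemma cayley_approximation_substitute:
  assumes S: "S \<subseteq> carrier G" and W: "\<And>t. t \<in> T \<Longrightarrow> W t \<in> lists S \<and> word_value G (W t) = t"
    and L: "\<And>t. t \<in> T \<Longrightarrow> length (W t) \<le> L"
    and N: "(n + 2) * L \<le> N" "0 < n" "n \<le> N"
    and \<Gamma>: "cayley_approximation G S N \<Gamma>"
  shows "cayley_approximation G T n (substitute W T \<Gamma>)"
proof -
  have fin: "finite_labeled_digraph S \<Gamma>"
    using \<Gamma> by (simp add: cayley_approximation_def)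
  obtain V where V: "V \<subseteq> vertices \<Gamma>" "real (card V) > (1 - 1 / real N) * real (card (vertices \<Gamma>))"
    and iso: "\<And>p. p \<in> V \<Longrightarrow> \<exists>g\<in>carrier G.
      rooted_isomorphic (neighborhood \<Gamma> N p) p (neighborhood (cayley_graph G S) N g) g"
    using \<Gamma> unfolding cayley_approximation_def by blast
  note wf = finite_labeled_digraph_imp_wf[OF fin] wf_cayley_graph[OF S]
  have "finite_labeled_digraph T (substitute W T \<Gamma>)"
    using fin edges_substitute_subset[OF wf(1)] by (simp add: finite_labeled_digraph_def)
  moreover have "(1 - 1 / real n) * real (card (vertices \<Gamma>)) \<le> (1 - 1 / real N) * real (card (vertices \<Gamma>))"
    using N by (intro mult_right_mono diff_left_mono divide_left_mono) auto
  moreover have "\<exists>g\<in>carrier G. rooted_isomorphic (neighborhood (substitute W T \<Gamma>) n p) p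
      (neighborhood (cayley_graph G T) n g) g" if p: "p \<in> V" for p
  proof -
    have pV: "p \<in> vertices \<Gamma>" using p V(1) by blast
    obtain g where g: "g \<in> carrier G" "balls_isomorphic \<Gamma> p (cayley_graph G S) g N"
      using iso[OF p, unfolded rooted_isomorphic_iff[OF pV]] by auto
    have "substitute W T (cayley_graph G S) = cayley_graph G T"
      by (rule substitute_cayley_graph[OF S W])
    moreover have "balls_isomorphic (substitute W T \<Gamma>) p (substitute W T (cayley_graph G S)) g n"
      by (rule balls_isomorphic_substitute[OF wf pV _ L g(2) N(1)]) (use g in auto)
    ultimately have "balls_isomorphic (substitute W T \<Gamma>) p (cayley_graph G T) g n"
      by simp
    then have "rooted_isomorphic (neighborhood (substitute W T \<Gamma>) n p) p
        (neighborhood (cayley_graph G T) n g) g"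
      by (rule rooted_isomorphic_iff[THEN iffD2, rotated]) (simp add: pV)
    then show ?thesis using g(1) by (rule bexI)
  qed
  ultimately show ?thesis
    unfolding cayley_approximation_def using V by (intro conjI exI[of _ V]) auto
qed

text \<open>Finitely many elements of the generated subgroup are represented by words of bounded length, so a
single sufficiently good approximation for \<open>S\<close> can be rewritten in terms of \<open>T\<close>. In
particular approximability does not depend on the choice of the generating set.\<close>

lemma cayley_approximations_generate:
  assumes S: "symmetric_subset G S" and T: "finite T" "T \<subseteq> generate G S"
    and approx: "\<And>N. N > 1 \<Longrightarrow> \<exists>\<Gamma> :: ('v, 'a) labeled_digraph. cayley_approximation G S N \<Gamma>"
    and n: "n > 1"
  shows "\<exists>\<Gamma> :: ('v, 'a) labeled_digraph. cayley_approximation G T n \<Gamma>"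
proof -
  have "\<forall>t\<in>T. \<exists>w. w \<in> lists S \<and> word_value G w = t"
    using T(2) unfolding generate_eq_word_values[OF S] by blast
  then obtain W where W: "\<And>t. t \<in> T \<Longrightarrow> W t \<in> lists S \<and> word_value G (W t) = t"
    by metis
  define L where "L = (\<Sum>t\<in>T. length (W t))"
  have L: "length (W t) \<le> L" if "t \<in> T" for t
    unfolding L_def using T(1) that by (intro member_le_sum) auto
  \<comment> \<open>The first summand is a sufficient radius, the second one a sufficient proportion of good vertices.\<close>
  define N where "N = (n + 2) * L + n"
  obtain \<Gamma> :: "('v, 'a) labeled_digraph" where "cayley_approximation G S N \<Gamma>"
    using approx[of N] n unfolding N_def by auto
  then have "cayley_approximation G T n (substitute W T \<Gamma>)"
    using S n by (intro cayley_approximation_substitute[OF _ W L]) (auto simp: N_def symmetric_subset_def)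
  then show ?thesis by blast
qed

end

text \<open>The ball around the identity in the Cayley graph, computed from finitely many products and without
reference to the carrier. It is therefore the same for a group and for its subgroups that contain
\<open>S\<close>, and it is locally constant as the group varies.\<close>

primrec word_ball :: "('a, 'b) monoid_scheme \<Rightarrow> 'a set \<Rightarrow> nat \<Rightarrow> 'a set" where
  "word_ball G S 0 = {\<one>\<^bsub>G\<^esub>}"
| "word_ball G S (Suc n) =
     word_ball G S n \<union> (\<lambda>(x, s). x \<otimes>\<^bsub>G\<^esub> s) ` (word_ball G S n \<times> S)"

definition word_ball_graph ::
  "('a, 'b) monoid_scheme \<Rightarrow> 'a set \<Rightarrow> nat \<Rightarrow> ('a, 'a) labeled_digraph" where
  "word_ball_graph G S n = \<lparr>vertices = word_ball G S n,
     edges = (\<lambda>(x, s). (x, s, x \<otimes>\<^bsub>G\<^esub> s)) ` (word_ball G S n \<times> S) \<inter>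
       UNIV \<times> UNIV \<times> word_ball G S n\<rparr>"

lemma word_ball_carrier_update [simp]: "word_ball (G\<lparr>carrier := H\<rparr>) S n = word_ball G S n"
  by (induction n) auto

lemma word_ball_graph_carrier_update [simp]:
  "word_ball_graph (G\<lparr>carrier := H\<rparr>) S n = word_ball_graph G S n"
  by (simp add: word_ball_graph_def)

lemma finite_word_ball: "finite S \<Longrightarrow> finite (word_ball G S n)"
  by (induction n) auto

context group begin

lemma adjacency_cayley_graph:
  assumes "symmetric_subset G S"
  shows "(u, v) \<in> adjacency (cayley_graph G S) \<longleftrightarrow> u \<in> carrier G \<and> (\<exists>s\<in>S. v = u \<otimes> s)"
proof -
  have S: "S \<subseteq> carrier G" "\<And>s. s \<in> S \<Longrightarrow> inv s \<in> S"
    using assms by (auto simp: symmetric_subset_def)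
  have "u \<in> carrier G \<and> (\<exists>s\<in>S. v = u \<otimes> s)" if "v \<in> carrier G" "s \<in> S" "u = v \<otimes> s" for s
  proof -
    have "s \<in> carrier G" using S(1) that(2) by blast
    then have "u \<in> carrier G" "v = u \<otimes> inv s"
      using that by (simp_all add: m_assoc)
    then show ?thesis using S(2)[OF that(2)] by blast
  qed
  then show ?thesis
    by (auto simp: adjacency_def edges_cayley_graph_iff)
qed

lemma graph_ball_cayley_graph:
  assumes "symmetric_subset G S"
  shows "graph_ball (cayley_graph G S) n \<one> = word_ball G S n"
proof (induction n)
  case 0
  then show ?case by (auto simp: graph_ball_0)
next
  case (Suc n)
  have S: "S \<subseteq> carrier G" using assms by (simp add: symmetric_subset_def)
  have "word_ball G S n \<subseteq> carrier G"
    using graph_ball_subset[of "cayley_graph G S" n \<one>] Suc by simp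
  then show ?case
    unfolding graph_ball_Suc[OF wf_cayley_graph[OF S]] adjacency_cayley_graph[OF assms] Suc
    by (auto simp: subset_iff)
qed

lemma neighborhood_cayley_graph_one:
  assumes "symmetric_subset G S"
  shows "neighborhood (cayley_graph G S) n \<one> = word_ball_graph G S n"
proof -
  have "word_ball G S n \<subseteq> carrier G"
    using graph_ball_subset[of "cayley_graph G S" n \<one>] graph_ball_cayley_graph[OF assms] by simp
  then have "{(u, s, v) \<in> edges (cayley_graph G S). u \<in> word_ball G S n \<and> v \<in> word_ball G S n} =
      (\<lambda>(x, s). (x, s, x \<otimes> s)) ` (word_ball G S n \<times> S) \<inter> UNIV \<times> UNIV \<times> word_ball G S n"
    by (auto simp: edges_cayley_graph_iff)
  then show ?thesis
    by (simp add: neighborhood_def word_ball_graph_def graph_ball_cayley_graph[OF assms])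
qed

text \<open>Left translations are automorphisms of the Cayley graph.\<close>

lemma balls_isomorphic_translate:
  assumes S: "S \<subseteq> carrier G" and gh: "g \<in> carrier G" "h \<in> carrier G"
  shows "balls_isomorphic (cayley_graph G S) g (cayley_graph G S) h n"
proof -
  have hom: "ball_hom (cayley_graph G S) x (cayley_graph G S) (a \<otimes> x) n (\<lambda>y. a \<otimes> y)"
    if "a \<in> carrier G" for a x
  proof (rule ball_hom_of_digraph_hom)
    show "a \<otimes> u \<in> vertices (cayley_graph G S)" if "u \<in> vertices (cayley_graph G S)" for u
      using that \<open>a \<in> carrier G\<close> by simp
    show "(a \<otimes> u, s, a \<otimes> v) \<in> edges (cayley_graph G S)" if "(u, s, v) \<in> edges (cayley_graph G S)" for u s v
      using that \<open>a \<in> carrier G\<close> S by (auto simp: edges_cayley_graph_iff m_assoc subset_iff)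
  qed
  define a where "a = h \<otimes> inv g"
  have a: "a \<in> carrier G" "a \<otimes> g = h" "inv a \<otimes> h = g"
    using gh by (simp_all add: a_def m_assoc inv_mult_group)
  have "\<forall>u\<in>graph_ball (cayley_graph G S) n x. inv a \<otimes> (a \<otimes> u) = u \<and> a \<otimes> (inv a \<otimes> u) = u" for x
    using a(1) graph_ball_subset[of "cayley_graph G S" n x] by (auto simp: m_assoc[symmetric] subset_iff)
  then show ?thesis
    unfolding balls_isomorphic_def
    using hom[OF a(1), of g] hom[OF inv_closed[OF a(1)], of h] a(2,3)
    by (intro exI[of _ "\<lambda>y. a \<otimes> y"] exI[of _ "\<lambda>y. inv a \<otimes> y"]) auto
qed

text \<open>By homogeneity all centres in the Cayley graph may be replaced by the identity. Thus the group
enters only through one rooted labelled graph.\<close>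

lemma cayley_approximation_iff:
  assumes S: "symmetric_subset G S"
  shows "cayley_approximation G S n \<Gamma> \<longleftrightarrow> finite_labeled_digraph S \<Gamma> \<and>
    (\<exists>W\<subseteq>vertices \<Gamma>. real (card W) > (1 - 1 / real n) * real (card (vertices \<Gamma>)) \<and>
      (\<forall>p\<in>W. rooted_isomorphic (neighborhood \<Gamma> n p) p (word_ball_graph G S n) \<one>))"
proof -
  have SG: "S \<subseteq> carrier G" using S by (simp add: symmetric_subset_def)
  have "(\<exists>g\<in>carrier G.
        rooted_isomorphic (neighborhood \<Gamma> n p) p (neighborhood (cayley_graph G S) n g) g) \<longleftrightarrow>
      rooted_isomorphic (neighborhood \<Gamma> n p) p (word_ball_graph G S n) \<one>"
    if p: "p \<in> vertices \<Gamma>" for p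
    unfolding neighborhood_cayley_graph_one[OF S, symmetric] rooted_isomorphic_iff[OF p]
  proof
    assume "\<exists>g\<in>carrier G. balls_isomorphic \<Gamma> p (cayley_graph G S) g n"
    then obtain g where g: "g \<in> carrier G" "balls_isomorphic \<Gamma> p (cayley_graph G S) g n"
      by (rule bexE)
    show "balls_isomorphic \<Gamma> p (cayley_graph G S) \<one> n"
      by (rule balls_isomorphic_trans[OF g(2) balls_isomorphic_translate[OF SG g(1) one_closed]])
  qed (rule bexI[OF _ one_closed])
  then show ?thesis
    unfolding cayley_approximation_def by (meson subsetD)
qed

lemma cayley_approximation_subgroup:
  assumes H: "subgroup H G" and S: "symmetric_subset G S" "S \<subseteq> H"
  shows "cayley_approximation (G\<lparr>carrier := H\<rparr>) S n \<Gamma> \<longleftrightarrow> cayley_approximation G S n \<Gamma>"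
proof -
  have "symmetric_subset (G\<lparr>carrier := H\<rparr>) S"
    using S m_inv_consistent[OF H] by (auto simp: symmetric_subset_def)
  from group.cayley_approximation_iff[OF subgroup_imp_group[OF H] this]
  show ?thesis
    by (simp add: cayley_approximation_iff[OF S(1)])
qed

text \<open>The existential quantifier over generating sets in the definition of soficity can be replaced by
a universal one over all finite symmetric subsets, because approximations can be transferred from
one generating set to another. This form turns soficity into an intersection of conditions on
finite subsets.\<close>

lemma sofic_iff:
  "sofic G \<longleftrightarrow> (\<forall>S n. finite S \<and> symmetric_subset G S \<and> n > 1 \<longrightarrow>
     (\<exists>\<Gamma> :: (nat, 'a) labeled_digraph. cayley_approximation G S n \<Gamma>))" (is "_ \<longleftrightarrow> ?R")
proof
  assume G: "sofic G"
  show ?R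
  proof (intro allI impI, elim conjE)
    fix S and n :: nat assume S: "finite S" "symmetric_subset G S" and n: "n > 1"
    let ?H = "generate G S"
    have SG: "S \<subseteq> carrier G" using S by (simp add: symmetric_subset_def)
    have H: "subgroup ?H G" by (rule generate_is_subgroup[OF SG])
    have SH: "S \<subseteq> ?H" by (auto intro: generate.incl)
    have "finitely_generated (G\<lparr>carrier := ?H\<rparr>)"
      unfolding finitely_generated_def using S SH generate_consistent[OF SH H] by auto
    then have "fg_sofic (G\<lparr>carrier := ?H\<rparr>)"
      using G H unfolding sofic_def by blast
    then obtain S' where S': "symmetric_generating_set (G\<lparr>carrier := ?H\<rparr>) S'"
      and approx: "\<And>N. N > 1 \<Longrightarrow>
        \<exists>\<Gamma> :: (nat, 'a) labeled_digraph. cayley_approximation (G\<lparr>carrier := ?H\<rparr>) S' N \<Gamma>"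
      unfolding fg_sofic_def by blast
    have S'H: "S' \<subseteq> ?H" "generate G S' = ?H"
      using S' generate_consistent[OF _ H, of S'] by (auto simp: symmetric_generating_set_def)
    have sym: "symmetric_subset G S'"
      using S' S'H subgroup.subset[OF H] m_inv_consistent[OF H]
      by (auto simp: symmetric_subset_def symmetric_generating_set_def subset_iff)
    have approx': "\<exists>\<Gamma> :: (nat, 'a) labeled_digraph. cayley_approximation G S' N \<Gamma>" if "N > 1" for N
      using approx[OF that] unfolding cayley_approximation_subgroup[OF H sym S'H(1)] .
    show "\<exists>\<Gamma> :: (nat, 'a) labeled_digraph. cayley_approximation G S n \<Gamma>"
      by (rule cayley_approximations_generate[OF sym S(1) _ approx' n]) (use S'H SH in simp_all)
  qed
next
  assume R: ?R
  show "sofic G"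
    unfolding sofic_def
  proof (intro allI impI, elim conjE)
    fix H assume H: "subgroup H G" "finitely_generated (G\<lparr>carrier := H\<rparr>)"
    then obtain S0 where S0: "finite S0" "S0 \<subseteq> H" "generate (G\<lparr>carrier := H\<rparr>) S0 = H"
      by (auto simp: finitely_generated_def)
    define S where "S = S0 \<union> m_inv G ` S0"
    have S0G: "S0 \<subseteq> carrier G"
      using S0(2) subgroup.subset[OF H(1)] by blast
    have S: "finite S" "symmetric_subset G S" "generate G S = H"
      using symmetrize[OF S0G] S0 generate_consistent[OF S0(2) H(1)] by (auto simp: S_def)
    have SH: "S \<subseteq> H" using generate.incl[of _ S G] S(3) by auto
    have "symmetric_generating_set (G\<lparr>carrier := H\<rparr>) S"
      using S SH m_inv_consistent[OF H(1)] generate_consistent[OF SH H(1)]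
      by (auto simp: symmetric_generating_set_def symmetric_subset_def)
    moreover have "\<exists>\<Gamma> :: (nat, 'a) labeled_digraph. cayley_approximation (G\<lparr>carrier := H\<rparr>) S n \<Gamma>"
      if "n > 1" for n
      unfolding cayley_approximation_subgroup[OF H(1) S(2) SH] using R S that by simp
    ultimately show "fg_sofic (G\<lparr>carrier := H\<rparr>)"
      unfolding fg_sofic_def using S(1) by (intro exI[of _ S]) simp
  qed
qed

end

lemma word_ball_subset_carrier:
  assumes "group G" "S \<subseteq> carrier G"
  shows "word_ball G S n \<subseteq> carrier G"
proof -
  interpret group G by fact
  show ?thesis
    by (induction n) (use assms(2) in auto)
qed

lemma locally_constant_bind_word_ball:
  assumes S: "finite S" "S \<subseteq> Pos"
    and ball: "locally_constant enumerated_group_space (\<lambda>c. word_ball (coded_monoid c) S n)"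
    and g: "\<And>B. finite B \<Longrightarrow> B \<subseteq> Pos \<Longrightarrow> locally_constant enumerated_group_space (g B)"
  shows "locally_constant enumerated_group_space (\<lambda>c. g (word_ball (coded_monoid c) S n) c)"
proof (rule locally_constant_bind[OF ball])
  fix c assume "c \<in> topspace enumerated_group_space"
  then have "word_ball (coded_monoid c) S n \<subseteq> Pos"
    using word_ball_subset_carrier[OF group_coded_monoid, of c S n] S(2) by simp
  then show "locally_constant enumerated_group_space (g (word_ball (coded_monoid c) S n))"
    by (rule g[OF finite_word_ball[OF S(1)]])
qed

lemma locally_constant_word_ball:
  assumes S: "finite S" "S \<subseteq> Pos"
  shows "locally_constant enumerated_group_space (\<lambda>c. word_ball (coded_monoid c) S n)"
proof (induction n)
  case 0
  then show ?case
    using locally_constant_apply[OF locally_constant_one, where F = "\<lambda>e. {e}"] by simp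
next
  case (Suc n)
  have "locally_constant enumerated_group_space (\<lambda>c. B \<union> (\<lambda>(x, s). x \<otimes>\<^bsub>coded_monoid c\<^esub> s) ` (B \<times> S))"
    if B: "finite B" "B \<subseteq> Pos" for B
  proof -
    have "locally_constant enumerated_group_space (\<lambda>c. (\<lambda>p. fst p \<otimes>\<^bsub>coded_monoid c\<^esub> snd p) ` (B \<times> S))"
      using S B by (intro locally_constant_image locally_constant_mult locally_constant_const) auto
    from locally_constant_apply[OF this, of "\<lambda>A. B \<union> A"] show ?thesis
      by (simp add: case_prod_beta')
  qed
  from locally_constant_bind_word_ball[OF S Suc this] show ?case
    by simp
qed

lemma locally_constant_word_ball_graph:
  assumes S: "finite S" "S \<subseteq> Pos"
  shows "locally_constant enumerated_group_space (\<lambda>c. word_ball_graph (coded_monoid c) S n)"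
proof -
  have "locally_constant enumerated_group_space
      (\<lambda>c. (\<lambda>(x, s). (x, s, x \<otimes>\<^bsub>coded_monoid c\<^esub> s)) ` (B \<times> S))"
    if B: "finite B" "B \<subseteq> Pos" for B
    unfolding case_prod_beta'
    using S B by (intro locally_constant_image locally_constant_mult locally_constant_const
      locally_constant_apply[where F = "\<lambda>y. (_, _, y)"]) auto
  from locally_constant_bind_word_ball[OF S locally_constant_word_ball[OF S] this]
  have "locally_constant enumerated_group_space (\<lambda>c. (\<lambda>(x, s). (x, s, x \<otimes>\<^bsub>coded_monoid c\<^esub> s)) `
      (word_ball (coded_monoid c) S n \<times> S))" .
  from locally_constant_apply2[OF locally_constant_word_ball[OF S, of n] this,
      of "\<lambda>B E. \<lparr>vertices = B, edges = E \<inter> UNIV \<times> UNIV \<times> B\<rparr>"]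
  show ?thesis
    by (simp add: word_ball_graph_def)
qed

text \<open>For fixed \<open>S\<close> and \<open>n\<close>, both the symmetry of \<open>S\<close> and the ball that has to be
approximated are locally constant.\<close>

lemma closedin_sofic:
  "closedin enumerated_group_space {c \<in> enumerated_groups. sofic (coded_monoid c)}"
proof -
  let ?E = "enumerated_group_space"
  define A :: "nat set \<Rightarrow> nat \<Rightarrow> (nat, nat) labeled_digraph \<Rightarrow> nat \<Rightarrow> bool" where
    "A S n B e \<longleftrightarrow> (\<exists>\<Gamma> :: (nat, nat) labeled_digraph. finite_labeled_digraph S \<Gamma> \<and>
      (\<exists>W\<subseteq>vertices \<Gamma>. real (card W) > (1 - 1 / real n) * real (card (vertices \<Gamma>)) \<and>
        (\<forall>p\<in>W. rooted_isomorphic (neighborhood \<Gamma> n p) p B e)))" for S n B e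
  let ?P = "\<lambda>S n c. A S n (word_ball_graph (coded_monoid c) S n) \<one>\<^bsub>coded_monoid c\<^esub>"
  have "sofic (coded_monoid c) \<longleftrightarrow> (\<forall>S n. finite S \<and> S \<subseteq> Pos \<and> n > 1 \<longrightarrow>
      symmetric_subset (coded_monoid c) S \<longrightarrow> ?P S n c)"
    if c: "c \<in> enumerated_groups" for c
  proof -
    interpret group "coded_monoid c" by (rule group_coded_monoid[OF c])
    have "?P S n c \<longleftrightarrow> (\<exists>\<Gamma> :: (nat, nat) labeled_digraph. cayley_approximation (coded_monoid c) S n \<Gamma>)"
      if "symmetric_subset (coded_monoid c) S" for S n
      by (simp only: A_def cayley_approximation_iff[OF that])
    moreover have "symmetric_subset (coded_monoid c) S \<Longrightarrow> S \<subseteq> Pos" for S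
      by (simp add: symmetric_subset_def)
    ultimately show ?thesis
      unfolding sofic_iff by meson
  qed
  then have "{c \<in> enumerated_groups. sofic (coded_monoid c)} =
    {c \<in> topspace ?E. \<forall>S n. finite S \<and> S \<subseteq> Pos \<and> n > 1 \<longrightarrow>
      symmetric_subset (coded_monoid c) S \<longrightarrow> ?P S n c}"
    unfolding topspace_enumerated_group_space by (intro Collect_cong conj_cong refl)
  moreover have "closedin ?E \<dots>"
  proof (intro closedin_Collect_all closedin_Collect_imp)
    fix S :: "nat set" and n :: nat assume S: "finite S \<and> S \<subseteq> Pos \<and> n > 1"
    then show "closedin ?E {c \<in> topspace ?E. symmetric_subset (coded_monoid c) S \<longrightarrow> ?P S n c}"
      by (intro closedin_Collect_locally_constant_imp closedin_locally_constant
          locally_constant_symmetric_subset locally_constant_apply2[where F = "A S n"]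
          locally_constant_word_ball_graph locally_constant_one) auto
  qed
  ultimately show ?thesis by simp
qed

section \<open>Closedness of the six properties\<close>

theorem proposition3p4p4:
  fixes P :: "nat monoid \<Rightarrow> bool"
  assumes "P \<in> {left_orderable, biorderable, locally_indicable, unique_product_property,
                 sofic, torsion_free}"
  shows "closedin enumerated_group_space {c \<in> enumerated_groups. P (coded_monoid c)} \<and>
         polish_topology
           (subtopology enumerated_group_space {c \<in> enumerated_groups. P (coded_monoid c)})"
proof -
  have "closedin enumerated_group_space {c \<in> enumerated_groups. P (coded_monoid c)}"
    using assms closedin_left_orderable closedin_biorderable closedin_locally_indicable
      closedin_unique_product_property closedin_sofic closedin_torsion_free
    by (elim insertE) simp_all
  then show ?thesis
    using polish_closed_subspace by simp
qed

end
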